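(* Let $m,k\ge 0$, $\alpha_1,\ldots,\alpha_m\ge 2$, $\beta_1,\ldots,\beta_k\ge 1$ be integers, and let $n=\sum_{j=1}^m\alpha_j+\sum_{i=1}^k\beta_i$ and $M=\sum_{j=1}^m\alpha_j$. Then the following statements are true. 1. If $m=0$, then for all pairwise distinct $b_1,\ldots,b_k\in\mathbb K$ the polynomial $f(x)=(x-b_1)^{\beta_1}\cdots(x-b_k)^{\beta_k}$ has an $S$-full integral with respect to $S=\emptyset$. 2. If $m=1$, then for all pairwise distinct $a,b_1,\ldots,b_k\in\mathbb K$ the polynomial $f(x)=(x-a)^{\alpha_1}(x-b_1)^{\beta_1}\cdots(x-b_k)^{\beta_k}$ has an $S$-full integral with respect to $S=\{a\}$. 3. If $2\le m\le n-M+1$, then there exist pairwise distinct $a_1,\ldots,a_m,b_1,\ldots,b_k\in\overline{\mathbb Q}$ such that the polynomial $f_1(x)=(x-a_1)^{\alpha_1}\cdots(x-a_m)^{\alpha_m}(x-b_1)^{\beta_1}\cdots(x-b_k)^{\beta_k}$ has an $S$-full integral with respect to $S=\{a_1,\ldots,a_m\}$, and there exist pairwise distinct $a_1',\ldots,a_m',b_1',\ldots,b_k'\in\overline{\mathbb Q}$ such that the polynomial $f_2(x)=(x-a_1')^{\alpha_1}\cdots(x-a_m')^{\alpha_m}(x-b_1')^{\beta_1}\cdots(x-b_k')^{\beta_k}$ does not have an $S$-full integral with respect to $S=\{a_1',\ldots,a_m'\}$. 4. If $m>n-M+1$, then for all pairwise distinct $a_1,\ldots,a_m,b_1,\ldots,b_k\in\mathbb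 K$ the polynomial $f(x)=(x-a_1)^{\alpha_1}\cdots(x-a_m)^{\alpha_m}(x-b_1)^{\beta_1}\cdots(x-b_k)^{\beta_k}$ does not have an $S$-full integral with respect to $S=\{a_1,\ldots,a_m\}$. In particular, there exists a polynomial of the form $f(x)=(x-a_1)^{\alpha_1}\cdots(x-a_m)^{\alpha_m}(x-b_1)^{\beta_1}\cdots(x-b_k)^{\beta_k}$ with pairwise distinct $a_1,\ldots,a_m,b_1,\ldots,b_k\in\mathbb K$ that is $S$-full integrable with respect to $S=\{a_1,\ldots,a_m\}$ if and only if $m\le n-M+1$.
   Context: $\mathbb K$ is an algebraically closed subfield of $\mathbb C$ (so $\overline{\mathbb Q}\subseteq\mathbb K$, where $\overline{\mathbb Q}$ is the algebraic closure of $\mathbb Q$ in $\mathbb C$). Let $f(x)\in\mathbb K[x]$, let $Z'(f)$ be the set of zeros of $f$ of multiplicity at least two, and let $S\subseteq Z'(f)$. A polynomial $F(x)\in\mathbb K[x]$ is called an $S$-full integral of $f$ (or an $S$-full integral with respect to $S$) if $F'(x)=f(x)$ and $F(t)=0$ for every $t\in S$. The polynomial $f$ is called $S$-full integrable if there exists an $S$-full integral of $f$. *)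

theory Defs
  imports Complex_Main "HOL-Computational_Algebra.Polynomial"
begin

definition polys_over :: "complex set \<Rightarrow> complex poly set"
  where "polys_over K = {p. \<forall>i. coeff p i \<in> K}"

definition complex_subfield :: "complex set \<Rightarrow> bool"
  where "complex_subfield K \<longleftrightarrow>
    0 \<in> K \<and> 1 \<in> K \<and>
    (\<forall>x\<in>K. \<forall>y\<in>K. x + y \<in> K \<and> x * y \<in> K) \<and>
    (\<forall>x\<in>K. - x \<in> K) \<and>
    (\<forall>x\<in>K. x \<noteq> 0 \<longrightarrow> inverse x \<in> K)"

definition alg_closed_subfield :: "complex set \<Rightarrow> bool"
  where "alg_closed_subfield K \<longleftrightarrow>
    complex_subfield K \<and>
    (\<forall>p\<in>polys_over K. degree p > 0 \<longrightarrow> (\<exists>z\<in>K. poly p z = 0))"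

definition Qbar :: "complex set"
  where "Qbar = {z. algebraic z}"

(* The set Z'(f). The library leaves order t 0 unspecified; every point is
   regarded as a zero of infinite multiplicity of the zero polynomial. *)
definition multiple_zeros :: "complex set \<Rightarrow> complex poly \<Rightarrow> complex set"
  where "multiple_zeros K f = {t \<in> K. f = 0 \<or> 2 \<le> order t f}"

(* The standing assumptions f \<in> K[x] and S \<subseteq> Z'(f) are part of the predicate. They hold
   for all the polynomials considered below, see full_integral_product_iff, so that
   negated instances never hold merely because an assumption fails. *)
definition full_integral :: "complex set \<Rightarrow> complex set \<Rightarrow> complex poly \<Rightarrow> complex poly \<Rightarrow> bool"
  where "full_integral K S f F \<longleftrightarrow>
    f \<in> polys_over K \<and> S \<subseteq> multiple_zeros K f \<and>
    F \<in> polys_over K \<and> pderiv F = f \<and> (\<forall>t\<in>S. poly F t = 0)"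

definition full_integrable :: "complex set \<Rightarrow> complex set \<Rightarrow> complex poly \<Rightarrow> bool"
  where "full_integrable K S f \<longleftrightarrow> (\<exists>F. full_integral K S f F)"

definition root_product :: "nat \<Rightarrow> (nat \<Rightarrow> nat) \<Rightarrow> (nat \<Rightarrow> complex) \<Rightarrow> complex poly"
  where "root_product m \<alpha> a = (\<Prod>j=1..m. [:- a j, 1:] ^ \<alpha> j)"

definition distinct_points ::
    "complex set \<Rightarrow> nat \<Rightarrow> (nat \<Rightarrow> complex) \<Rightarrow> nat \<Rightarrow> (nat \<Rightarrow> complex) \<Rightarrow> bool"
  where "distinct_points K m a k b \<longleftrightarrow>
    a ` {1..m} \<subseteq> K \<and> b ` {1..k} \<subseteq> K \<and>
    inj_on a {1..m} \<and> inj_on b {1..k} \<and> a ` {1..m} \<inter> b ` {1..k} = {}"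

lemma complex_subfield_sum:
  assumes "complex_subfield K" "\<And>i. i \<in> A \<Longrightarrow> g i \<in> K"
  shows "sum g A \<in> K"
  using assms(2)
  by (induction A rule: infinite_finite_induct)
     (use assms(1) in \<open>auto simp: complex_subfield_def\<close>)

lemma polys_over_mult:
  assumes "complex_subfield K" "p \<in> polys_over K" "q \<in> polys_over K"
  shows "p * q \<in> polys_over K"
proof -
  have "coeff (p * q) n \<in> K" for n
    unfolding coeff_mult
    by (rule complex_subfield_sum[OF assms(1)])
       (use assms in \<open>auto simp: polys_over_def complex_subfield_def\<close>)
  then show ?thesis by (simp add: polys_over_def)
qed

lemma polys_over_1: "complex_subfield K \<Longrightarrow> 1 \<in> polys_over K"
  by (auto simp: polys_over_def complex_subfield_def)

lemma polys_over_power: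
  assumes "complex_subfield K" "p \<in> polys_over K"
  shows "p ^ n \<in> polys_over K"
  by (induction n) (auto intro: polys_over_1 polys_over_mult assms)

lemma polys_over_root_product:
  assumes "complex_subfield K" "a ` {1..m} \<subseteq> K"
  shows "root_product m \<alpha> a \<in> polys_over K"
proof -
  have "[:- a j, 1:] \<in> polys_over K" if "j \<in> {1..m}" for j
  proof -
    have "a j \<in> K" using assms(2) that by blast
    then show ?thesis
      using assms(1)
      by (auto simp: polys_over_def complex_subfield_def coeff_pCons split: nat.split)
  qed
  then have *: "[:- a j, 1:] ^ \<alpha> j \<in> polys_over K" if "j \<in> {1..m}" for j
    using that by (intro polys_over_power assms(1))
  have "(\<Prod>j\<in>A. [:- a j, 1:] ^ \<alpha> j) \<in> polys_over K" if "A \<subseteq> {1..m}" for A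
    using that
  proof (induction A rule: infinite_finite_induct)
    case (insert x A)
    then have "[:- a x, 1:] ^ \<alpha> x * (\<Prod>j\<in>A. [:- a j, 1:] ^ \<alpha> j) \<in> polys_over K"
      by (intro polys_over_mult assms(1) *) blast+
    then show ?case using insert.hyps by simp
  qed (simp_all add: polys_over_1 assms(1))
  then show ?thesis by (simp add: root_product_def)
qed

lemma multiple_zeros_root_product:
  assumes "a ` {1..m} \<subseteq> K" "\<And>j. j \<in> {1..m} \<Longrightarrow> 2 \<le> \<alpha> j"
  shows "a ` {1..m} \<subseteq> multiple_zeros K (root_product m \<alpha> a * q)"
proof
  fix t assume "t \<in> a ` {1..m}"
  then obtain j where j: "j \<in> {1..m}" "t = a j" by blast
  have "[:- t, 1:] ^ 2 dvd [:- a j, 1:] ^ \<alpha> j"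
    using j assms(2) by (simp add: le_imp_power_dvd)
  also have "\<dots> dvd root_product m \<alpha> a"
    unfolding root_product_def using j(1) by (intro dvd_prodI) auto
  finally have "[:- t, 1:] ^ 2 dvd root_product m \<alpha> a * q" by simp
  then show "t \<in> multiple_zeros K (root_product m \<alpha> a * q)"
    using j assms(1) by (auto simp: multiple_zeros_def order_divides simp del: mult_eq_0_iff)
qed

lemma full_integral_product_iff:
  assumes "complex_subfield K" "distinct_points K m a k b" "\<forall>j\<in>{1..m}. 2 \<le> \<alpha> j"
    and f_def: "f = root_product m \<alpha> a * root_product k \<beta> b"
  shows "full_integral K (a ` {1..m}) f F \<longleftrightarrow>
    F \<in> polys_over K \<and> pderiv F = f \<and> (\<forall>t\<in>a ` {1..m}. poly F t = 0)"
proof -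
  have "f \<in> polys_over K"
    using assms(1,2) unfolding f_def distinct_points_def
    by (intro polys_over_mult polys_over_root_product) auto
  moreover have "a ` {1..m} \<subseteq> multiple_zeros K f"
    using assms(2,3) unfolding f_def distinct_points_def
    by (intro multiple_zeros_root_product) auto
  ultimately show ?thesis by (simp add: full_integral_def)
qed

end

theory Submission
  imports Defs "HOL-Analysis.Analysis" "HOL-Computational_Algebra.Fundamental_Theorem_Algebra"
begin

text \<open>
  A full integral is divisible by \<open>\<Prod>j. (x - a j) ^ (\<alpha> j + 1)\<close>, which bounds \<open>m\<close> by degrees. Failure at
  real points follows from the mean value theorem, as the real function \<open>f\<close> has no zero between
  neighbouring roots.

  For existence put \<open>B = n - M\<close> and look for \<open>F\<close> with \<open>B + 1\<close> distinct roots \<open>a j\<close> of multiplicities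
  \<open>w j = \<alpha> j + 1\<close>, where \<open>w j = 1\<close> for \<open>j > m\<close>. One needs \<open>\<Sum>j. w j / (x - a j)\<close> to vanish to order
  \<open>\<beta> i\<close> at \<open>b i\<close>. If all \<open>b i\<close> collapse to \<open>0\<close>, this becomes \<open>\<Sum>j. w j * c j ^ s = 0\<close> for \<open>s = 1, \<dots>, B\<close>
  with \<open>c j = 1 / a j\<close>. For positive real weights a Vandermonde argument shows that every nonzero
  solution has distinct nonzero entries and a surjective Jacobian. Hence the set of parameters for
  which a solution exists is open and, by compactness, closed along the segment from the weights
  \<open>1, \<dots>, 1\<close>, where roots of unity are a solution, to \<open>w\<close>. Since the Jacobian is surjective the
  solution persists when the \<open>b i\<close> are moved apart to distinct small rational numbers. Finally, the
  complex solution is specialized to algebraic numbers, keeping the \<open>a j\<close> distinct, by extending a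
  ring homomorphism into \<open>Qbar\<close> one generator at a time.\<close>

section \<open>Subrings of the complex numbers and algebraic numbers\<close>

definition subring_on :: "complex set \<Rightarrow> bool"
  where "subring_on R \<longleftrightarrow> 0 \<in> R \<and> 1 \<in> R \<and>
    (\<forall>x\<in>R. \<forall>y\<in>R. x + y \<in> R \<and> x * y \<in> R) \<and> (\<forall>x\<in>R. - x \<in> R)"

definition adjoin :: "complex set \<Rightarrow> complex \<Rightarrow> complex set"
  where "adjoin R x = (\<lambda>p. poly p x) ` polys_over R"

lemma subring_onD:
  assumes "subring_on R"
  shows "0 \<in> R" "1 \<in> R" "x \<in> R \<Longrightarrow> y \<in> R \<Longrightarrow> x + y \<in> R"
    "x \<in> R \<Longrightarrow> y \<in> R \<Longrightarrow> x * y \<in> R" "x \<in> R \<Longrightarrow> - x \<in> R"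
  using assms by (auto simp: subring_on_def)

lemma subring_on_diff:
  assumes "subring_on R" "x \<in> R" "y \<in> R"
  shows "x - y \<in> R"
  using subring_onD(3)[OF assms(1) assms(2) subring_onD(5)[OF assms(1,3)]] by simp

lemma subring_on_sum:
  assumes "subring_on R" "\<And>i. i \<in> A \<Longrightarrow> g i \<in> R"
  shows "sum g A \<in> R"
  using assms(2) by (induction A rule: infinite_finite_induct) (auto intro: subring_onD[OF assms(1)])

lemma subring_on_prod:
  assumes "subring_on R" "\<And>i. i \<in> A \<Longrightarrow> g i \<in> R"
  shows "prod g A \<in> R"
  using assms(2) by (induction A rule: infinite_finite_induct) (auto intro: subring_onD[OF assms(1)])

lemma subring_on_power:
  assumes "subring_on R" "x \<in> R"
  shows "x ^ n \<in> R"
  by (induction n) (auto intro: subring_onD[OF assms(1)] assms(2))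

lemma subring_on_of_nat:
  assumes "subring_on R"
  shows "of_nat n \<in> R"
  by (induction n) (auto intro: subring_onD[OF assms(1)])

lemma complex_subfield_imp_subring_on: "complex_subfield K \<Longrightarrow> subring_on K"
  by (auto simp: complex_subfield_def subring_on_def)

lemma subring_on_Rats: "subring_on \<rat>"
  by (auto simp: subring_on_def)

lemma poly_in_subring:
  assumes "subring_on R" "p \<in> polys_over R" "x \<in> R"
  shows "poly p x \<in> R"
  unfolding poly_altdef using assms
  by (intro subring_on_sum subring_onD(4) subring_on_power) (auto simp: polys_over_def)

section \<open>Polynomials over a subring, simple ring extensions and pseudo-division\<close>

context
  fixes R :: "complex set"
  assumes R: "subring_on R"
begin

lemma polys_over_add_subring: "p \<in> polys_over R \<Longrightarrow> q \<in> polys_over R \<Longrightarrow> p + q \<in> polys_over R"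
  by (auto simp: polys_over_def intro: subring_onD[OF R])

lemma polys_over_diff_subring: "p \<in> polys_over R \<Longrightarrow> q \<in> polys_over R \<Longrightarrow> p - q \<in> polys_over R"
  by (auto simp: polys_over_def intro: subring_on_diff[OF R])

lemma polys_over_uminus_subring: "p \<in> polys_over R \<Longrightarrow> - p \<in> polys_over R"
  by (auto simp: polys_over_def intro: subring_onD[OF R])

lemma polys_over_mult_subring: "p \<in> polys_over R \<Longrightarrow> q \<in> polys_over R \<Longrightarrow> p * q \<in> polys_over R"
  by (auto simp: polys_over_def coeff_mult intro!: subring_on_sum[OF R] subring_onD[OF R])

lemma polys_over_smult_subring: "c \<in> R \<Longrightarrow> p \<in> polys_over R \<Longrightarrow> smult c p \<in> polys_over R"
  by (auto simp: polys_over_def intro: subring_onD[OF R])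

lemma polys_over_monom_subring: "c \<in> R \<Longrightarrow> monom c n \<in> polys_over R"
  by (auto simp: polys_over_def intro: subring_onD[OF R])

lemma polys_over_const_subring: "c \<in> R \<Longrightarrow> [:c:] \<in> polys_over R"
  using polys_over_monom_subring[of c 0] by (simp add: monom_0)

lemma polys_over_pCons_subring: "c \<in> R \<Longrightarrow> p \<in> polys_over R \<Longrightarrow> pCons c p \<in> polys_over R"
  by (auto simp: polys_over_def coeff_pCons split: nat.split)

lemma polys_over_0_subring: "0 \<in> polys_over R"
  by (auto simp: polys_over_def intro: subring_onD[OF R])

lemmas polys_over_subring_intros = polys_over_add_subring polys_over_diff_subring
  polys_over_uminus_subring polys_over_mult_subring polys_over_smult_subring
  polys_over_monom_subring polys_over_const_subring polys_over_pCons_subring polys_over_0_subring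

lemma subring_on_adjoin: "subring_on (adjoin R x)"
  unfolding subring_on_def adjoin_def
proof (intro conjI ballI)
  show "0 \<in> (\<lambda>p. poly p x) ` polys_over R"
    by (rule image_eqI[of _ _ 0]) (auto intro: polys_over_subring_intros)
  show "1 \<in> (\<lambda>p. poly p x) ` polys_over R"
    by (rule image_eqI[of _ _ "[:1:]"]) (auto intro!: polys_over_subring_intros subring_onD[OF R])
next
  fix u v assume "u \<in> (\<lambda>p. poly p x) ` polys_over R" "v \<in> (\<lambda>p. poly p x) ` polys_over R"
  then obtain p q where "p \<in> polys_over R" "u = poly p x" "q \<in> polys_over R" "v = poly q x" by auto
  then show "u + v \<in> (\<lambda>p. poly p x) ` polys_over R" "u * v \<in> (\<lambda>p. poly p x) ` polys_over R"
    by (auto simp: poly_add[symmetric] poly_mult[symmetric] simp del: poly_add poly_mult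
        intro!: imageI polys_over_subring_intros)
next
  fix u assume "u \<in> (\<lambda>p. poly p x) ` polys_over R"
  then show "- u \<in> (\<lambda>p. poly p x) ` polys_over R"
    by (auto simp: poly_minus[symmetric] simp del: poly_minus intro!: imageI polys_over_subring_intros)
qed

lemma subset_adjoin: "R \<subseteq> adjoin R x"
  unfolding adjoin_def by (auto intro!: image_eqI[of _ _ "[:_:]"] polys_over_subring_intros)

lemma mem_adjoin: "x \<in> adjoin R x"
  unfolding adjoin_def
  by (rule image_eqI[of _ _ "[:0, 1:]"]) (auto intro!: polys_over_subring_intros subring_onD[OF R])

text \<open>\<open>R\<close> is only a ring, so the leading coefficient of \<open>h\<close> cannot
  be inverted. Multiplying \<open>p\<close> by it before each cancellation keeps all coefficients in
  \<open>R\<close> and accounts for the power on the left.\<close>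

lemma pseudo_division_over:
  assumes h: "h \<in> polys_over R" "h \<noteq> 0" and p: "p \<in> polys_over R"
  shows "\<exists>N. \<exists>k\<in>polys_over R. \<exists>g\<in>polys_over R.
    smult (lead_coeff h ^ N) p = h * k + g \<and> (g = 0 \<or> degree g < degree h)"
  using p
\<comment> \<open>The measure separates 0 from the nonzero constants, which share degree 0: dividing
  a constant by a constant must count as progress.\<close>
proof (induction "if p = 0 then 0 else Suc (degree p)" arbitrary: p rule: less_induct)
  case less
  show ?case
  proof (cases "p = 0 \<or> degree p < degree h")
    case True
    then show ?thesis using less.prems
      by (intro exI[of _ 0] bexI[of _ 0] bexI[of _ p]) (auto intro: polys_over_subring_intros)
  next
    case False
    define q where "q = monom (lead_coeff p) (degree p - degree h)"
    define p' where "p' = smult (lead_coeff h) p - h * q"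
    have q: "q \<in> polys_over R" using less.prems
      by (auto simp: q_def polys_over_def intro: subring_onD[OF R])
    have p': "p' \<in> polys_over R" unfolding p'_def using less.prems h q
      by (intro polys_over_subring_intros) (auto simp: polys_over_def)
    have "lead_coeff p \<noteq> 0" using False by auto
    then have dq: "degree q = degree p - degree h" by (simp add: q_def degree_monom_eq)
    have deg: "degree p' \<le> degree p" unfolding p'_def
      using False h by (intro degree_diff_le) (auto simp: degree_mult_eq_0 dq intro!: order.trans[OF degree_mult_le])
    have "coeff (h * q) (degree h + degree q) = lead_coeff h * lead_coeff q"
      by (rule coeff_mult_degree_sum)
    then have "coeff p' (degree p) = 0" using False dq
      by (simp add: p'_def) (simp add: q_def degree_monom_eq)
    then have "p' = 0 \<or> degree p' < degree p" using deg
      by (metis le_neq_implies_less leading_coeff_0_iff)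
    then have "(if p' = 0 then 0 else Suc (degree p')) < (if p = 0 then 0 else Suc (degree p))"
      using False by auto
    from less.hyps[OF this p'] obtain N k g where
      *: "k \<in> polys_over R" "g \<in> polys_over R" "smult (lead_coeff h ^ N) p' = h * k + g"
      "g = 0 \<or> degree g < degree h" by blast
    have "smult (lead_coeff h ^ Suc N) p = h * (k + smult (lead_coeff h ^ N) q) + g"
      using *(3) unfolding p'_def by (simp add: algebra_simps smult_diff_right)
    moreover have "k + smult (lead_coeff h ^ N) q \<in> polys_over R"
      using * q h by (intro polys_over_subring_intros subring_on_power[OF R]) (auto simp: polys_over_def)
    ultimately show ?thesis using * by blast
  qed
qed

end

section \<open>Rings of finite dimension over the rationals\<close>

interpretation rat_complex: vector_space "\<lambda>(q::rat) (x::complex). of_rat q * x"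
  by unfold_locales (simp_all add: algebra_simps of_rat_add of_rat_mult)

text \<open>Finite dimension is encoded by containment in the span of a finite set, so that no basis
  of \<open>A\<close> itself has to be exhibited.\<close>

definition finite_algebra :: "complex set \<Rightarrow> bool"
  where "finite_algebra A \<longleftrightarrow> subring_on A \<and> \<rat> \<subseteq> A \<and> (\<exists>S. finite S \<and> A \<subseteq> rat_complex.span S)"

lemma finite_algebra_Rats: "finite_algebra \<rat>"
proof -
  have "\<rat> \<subseteq> rat_complex.span {1::complex}"
  proof
    fix x :: complex assume "x \<in> \<rat>"
    then obtain r where "x = of_rat r" by (auto elim: Rats_cases)
    then show "x \<in> rat_complex.span {1}"
      using rat_complex.span_scale[OF rat_complex.span_base[of 1 "{1}"], of r] by simp
  qed
  then show ?thesis unfolding finite_algebra_def using subring_on_Rats by blast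
qed

text \<open>Dimension count: the powers of \<open>z\<close> with exponents 0 to
  \<open>card S\<close> all lie in a space spanned by \<open>card S\<close> vectors, and a linear
  dependence between them is a rational polynomial with root \<open>z\<close>.\<close>

lemma finite_algebra_algebraic:
  assumes "finite_algebra A" "z \<in> A"
  shows "algebraic z"
proof -
  obtain S where S: "finite S" "A \<subseteq> rat_complex.span S" and A: "subring_on A"
    using assms by (auto simp: finite_algebra_def)
  define n where "n = card S"
  have in_span: "(\<lambda>i. z ^ i) ` {..n} \<subseteq> rat_complex.span S"
    using S(2) subring_on_power[OF A assms(2)] by blast
  show ?thesis
  \<comment> \<open>If two powers coincide, the set of powers is too small for the dimension count,
    but the difference of two monomials is already a relation.\<close>
  proof (cases "inj_on (\<lambda>i. z ^ i) {..n}")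
    case False
    then obtain i j where ij: "i \<noteq> j" "z ^ i = z ^ j" by (auto simp: inj_on_def)
    show ?thesis
    proof (rule algebraicI'[of "monom 1 i - monom 1 j"])
      have "coeff (monom 1 i - monom (1::complex) j) i \<noteq> 0" using ij by simp
      then show "monom 1 i - monom (1::complex) j \<noteq> 0" by force
    qed (use ij in \<open>auto simp: poly_monom\<close>)
  next
    case True
    have "rat_complex.dependent ((\<lambda>i. z ^ i) ` {..n})"
    proof (rule ccontr)
      assume "rat_complex.independent ((\<lambda>i. z ^ i) ` {..n})"
      from rat_complex.independent_span_bound[OF S(1) this in_span]
      show False using card_image[OF True] by (simp add: n_def)
    qed
    then obtain u v where u: "v \<in> (\<lambda>i. z ^ i) ` {..n}" "u v \<noteq> 0"
      "(\<Sum>v\<in>(\<lambda>i. z ^ i) ` {..n}. of_rat (u v) * v) = 0"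
      by (auto simp: rat_complex.dependent_finite)
    define p :: "complex poly" where "p = (\<Sum>i\<le>n. monom (of_rat (u (z ^ i))) i)"
    have cp: "coeff p i = (if i \<le> n then of_rat (u (z ^ i)) else 0)" for i
      by (simp add: p_def coeff_sum coeff_monom if_distrib cong: if_cong)
    show ?thesis
    proof (rule algebraicI'[of p])
      show "coeff p i \<in> \<rat>" for i by (simp add: cp)
      obtain i where "i \<le> n" "v = z ^ i" using u by auto
      then have "coeff p i \<noteq> 0" using u by (simp add: cp)
      then show "p \<noteq> 0" by force
      show "poly p z = 0" using u(3) by (simp add: p_def poly_sum poly_monom sum.reindex[OF True])
    qed
  qed
qed

text \<open>Division by the monic \<open>p\<close> replaces any polynomial in \<open>x\<close> by
  its remainder, so the products of elements of \<open>S\<close> with finitely many powers of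
  \<open>x\<close> span the extension.\<close>

lemma finite_algebra_adjoin:
  assumes A: "finite_algebra A" and p: "p \<in> polys_over A" "lead_coeff p = 1" "poly p x = 0"
  shows "finite_algebra (adjoin A x)"
proof -
  obtain S where S: "finite S" "A \<subseteq> rat_complex.span S" and sub: "subring_on A" and Q: "\<rat> \<subseteq> A"
    using A by (auto simp: finite_algebra_def)
  have mult_span: "v * y \<in> rat_complex.span T" if "v \<in> rat_complex.span S" "(\<lambda>s. s * y) ` S \<subseteq> T" for v y T
    using that(1)
  proof (induction v rule: rat_complex.span_induct_alt)
    case base then show ?case by (simp add: rat_complex.span_zero)
  next
    case (step c s v)
    then have "of_rat c * (s * y) \<in> rat_complex.span T"
      using that(2) by (intro rat_complex.span_scale rat_complex.span_base) auto
    from rat_complex.span_add[OF this step.IH] show ?case by (simp add: algebra_simps)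
  qed
  define T where "T = (\<lambda>(s, i). s * x ^ i) ` (S \<times> {..degree p})"
  have "adjoin A x \<subseteq> rat_complex.span T"
  proof
    fix w assume "w \<in> adjoin A x"
    then obtain q where q: "q \<in> polys_over A" "w = poly q x" by (auto simp: adjoin_def)
    have "p \<noteq> 0" using p(2) by auto
    from pseudo_division_over[OF sub p(1) this q(1)] obtain k g where
      g: "g \<in> polys_over A" "q = p * k + g" "g = 0 \<or> degree g < degree p" using p(2) by auto
    have "w = (\<Sum>i\<le>degree g. coeff g i * x ^ i)"
      using q(2) g(2) p(3) by (simp add: poly_altdef[symmetric])
    also have "\<dots> \<in> rat_complex.span T"
    proof (intro rat_complex.span_sum mult_span)
      fix i assume "i \<in> {..degree g}"
      show "coeff g i \<in> rat_complex.span S" using g(1) S(2) by (auto simp: polys_over_def)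
      show "(\<lambda>s. s * x ^ i) ` S \<subseteq> T" using \<open>i \<in> _\<close> g(3) by (auto simp: T_def)
    qed
    finally show "w \<in> rat_complex.span T" .
  qed
  moreover have "finite T" using S by (simp add: T_def)
  ultimately show ?thesis unfolding finite_algebra_def
    using subring_on_adjoin[OF sub] subset_adjoin[OF sub] Q by blast
qed

text \<open>A tower of simple extensions; each generator becomes integral once its rational
  polynomial is made monic.\<close>

lemma finite_algebra_contains:
  assumes "finite X" "X \<subseteq> Qbar"
  shows "\<exists>A. finite_algebra A \<and> X \<subseteq> A"
  using assms
proof (induction X)
  case empty
  then show ?case using finite_algebra_Rats by blast
next
  case (insert x X)
  then obtain A where A: "finite_algebra A" "X \<subseteq> A" by auto
  then have sub: "subring_on A" and Q: "\<rat> \<subseteq> A" by (auto simp: finite_algebra_def)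
  from insert.prems obtain p where p: "\<And>i. coeff p i \<in> \<rat>" "p \<noteq> 0" "poly p x = 0"
    by (auto simp: Qbar_def algebraic_altdef)
  define q where "q = smult (inverse (lead_coeff p)) p"
  have "q \<in> polys_over A" using p(1) Q by (auto simp: q_def polys_over_def intro!: subsetD[OF Q])
  moreover have "lead_coeff q = 1" "poly q x = 0" using p by (auto simp: q_def)
  ultimately have "finite_algebra (adjoin A x)" by (rule finite_algebra_adjoin[OF A(1)])
  moreover have "insert x X \<subseteq> adjoin A x"
    using mem_adjoin[OF sub] subset_adjoin[OF sub] A(2) by blast
  ultimately show ?case by blast
qed

text \<open>Both \<open>x + y\<close> and \<open>x * y\<close> lie in one finite algebra containing
  \<open>x\<close> and \<open>y\<close>, all of whose elements are algebraic.\<close>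

lemma complex_subfield_Qbar: "complex_subfield Qbar"
proof -
  have "x + y \<in> Qbar \<and> x * y \<in> Qbar" if xy: "x \<in> Qbar" "y \<in> Qbar" for x y
  proof -
    obtain A where A: "finite_algebra A" "{x, y} \<subseteq> A"
      using finite_algebra_contains[of "{x, y}"] xy by blast
    then have "x + y \<in> A" "x * y \<in> A" by (auto simp: finite_algebra_def intro: subring_onD)
    then show ?thesis using finite_algebra_algebraic[OF A(1)] by (simp add: Qbar_def)
  qed
  then show ?thesis by (auto simp: complex_subfield_def Qbar_def)
qed

text \<open>A complex root is integral over a finite algebra generated by the coefficients of the
  normalised polynomial, and adjoining it leaves the algebra finite.\<close>

lemma alg_closed_subfield_Qbar: "alg_closed_subfield Qbar"
  unfolding alg_closed_subfield_def
proof (intro conjI ballI impI complex_subfield_Qbar)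
  fix p assume p: "p \<in> polys_over Qbar" "degree p > 0"
  then obtain z where z: "poly p z = 0"
    using fundamental_theorem_of_algebra[of p] by (auto simp: constant_degree)
  have "p \<noteq> 0" using p by auto
  define q where "q = smult (inverse (lead_coeff p)) p"
  have q: "q \<in> polys_over Qbar" "lead_coeff q = 1" "poly q z = 0"
    using p z complex_subfield_Qbar \<open>p \<noteq> 0\<close> by (auto simp: q_def polys_over_def complex_subfield_def)
  obtain A where A: "finite_algebra A" "coeff q ` {..degree q} \<subseteq> A"
    using finite_algebra_contains[of "coeff q ` {..degree q}"] q by (auto simp: polys_over_def)
  have sub: "subring_on A" using A by (auto simp: finite_algebra_def)
  have "coeff q i \<in> A" for i
    using A(2) subring_onD(1)[OF sub] by (cases "i \<le> degree q") (auto simp: coeff_eq_0)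
  then have "q \<in> polys_over A" by (auto simp: polys_over_def)
  then have "finite_algebra (adjoin A z)" using q by (intro finite_algebra_adjoin[OF A(1)])
  then have "algebraic z" using mem_adjoin[OF sub] by (rule finite_algebra_algebraic)
  then show "\<exists>z\<in>Qbar. poly p z = 0" using z by (auto simp: Qbar_def)
qed

section \<open>The algebraic numbers inside an algebraically closed subfield\<close>

lemma complex_subfield_Rats_subset:
  assumes "complex_subfield K"
  shows "\<rat> \<subseteq> K"
proof
  fix x :: complex assume "x \<in> \<rat>"
  then obtain m n where mn: "n > 0" "x = of_int m / of_int n"
    by (auto elim: Rats_cases')
  have sub: "subring_on K" using assms by (rule complex_subfield_imp_subring_on)
  have int: "of_int i \<in> K" for i :: int
    using subring_on_of_nat[OF sub] subring_onD(5)[OF sub]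
    by (cases i rule: int_cases2) auto
  have "inverse (of_int n) \<in> K" using mn int[of n] assms by (auto simp: complex_subfield_def)
  then show "x \<in> K" using int[of m] mn subring_onD(4)[OF sub] by (auto simp: divide_inverse)
qed

text \<open>Roots in \<open>K\<close> are split off one by one. The cofactor stays over
  \<open>K\<close> because the divisor is monic, and \<open>x\<close> is either the split root or a
  root of the cofactor.\<close>

lemma alg_closed_subfield_root:
  assumes "alg_closed_subfield K"
  shows "p \<in> polys_over K \<Longrightarrow> p \<noteq> 0 \<Longrightarrow> poly p x = 0 \<Longrightarrow> x \<in> K"
proof (induction "degree p" arbitrary: p)
  case 0
  then obtain c where "p = [:c:]" by (metis degree_eq_zeroE)
  then show ?case using 0 by simp
next
  case (Suc n)
  have sub: "subring_on K" using assms by (auto simp: alg_closed_subfield_def intro: complex_subfield_imp_subring_on)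
  obtain z where z: "z \<in> K" "poly p z = 0" using assms Suc by (auto simp: alg_closed_subfield_def)
  have "[:- z, 1:] \<in> polys_over K"
    using z(1) by (intro polys_over_subring_intros[OF sub] subring_onD[OF sub])
  from pseudo_division_over[OF sub this _ Suc.prems(1)] obtain q g where
    q: "q \<in> polys_over K" "p = [:- z, 1:] * q + g" "g = 0 \<or> degree g = 0"
    by auto
  have "g = 0" using q z(2) by (auto elim!: degree_eq_zeroE)
  then have p: "p = [:- z, 1:] * q" using q by simp
  then have "q \<noteq> 0" using Suc by auto
  then have "degree p = Suc (degree q)" unfolding p by (subst degree_mult_eq) auto
  then have "poly q x = 0 \<Longrightarrow> x \<in> K" using Suc q \<open>q \<noteq> 0\<close> by auto
  then show ?case using z(1) Suc.prems(3) p by auto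
qed

lemma Qbar_subset:
  assumes "alg_closed_subfield K"
  shows "Qbar \<subseteq> K"
proof
  fix x assume "x \<in> Qbar"
  then obtain p where p: "\<And>i. coeff p i \<in> \<rat>" "p \<noteq> 0" "poly p x = 0"
    by (auto simp: Qbar_def algebraic_altdef)
  then have "p \<in> polys_over K" using complex_subfield_Rats_subset[of K] assms
    by (auto simp: polys_over_def alg_closed_subfield_def)
  then show "x \<in> K" using alg_closed_subfield_root[OF assms] p by blast
qed

section \<open>Specialization into an algebraically closed subfield\<close>

text \<open>A ring homomorphism defined on \<open>R\<close>, encoded as a total function whose
  values outside \<open>R\<close> are arbitrary. The clause \<open>f 0 = 0\<close> lets
  \<open>map_poly f\<close> act coefficientwise.\<close>

definition partial_hom :: "complex set \<Rightarrow> (complex \<Rightarrow> complex) \<Rightarrow> bool"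
  where "partial_hom R f \<longleftrightarrow> f 0 = 0 \<and> f 1 = 1 \<and>
    (\<forall>x\<in>R. \<forall>y\<in>R. f (x + y) = f x + f y \<and> f (x * y) = f x * f y)"

context
  fixes R :: "complex set" and f :: "complex \<Rightarrow> complex"
  assumes R: "subring_on R" and f: "partial_hom R f"
begin

lemma partial_hom_sum:
  assumes "\<And>i. i \<in> A \<Longrightarrow> g i \<in> R"
  shows "f (sum g A) = (\<Sum>i\<in>A. f (g i))"
  using assms f by (induction A rule: infinite_finite_induct)
    (auto simp: partial_hom_def subring_on_sum[OF R])

lemma partial_hom_prod:
  assumes "\<And>i. i \<in> A \<Longrightarrow> g i \<in> R"
  shows "f (prod g A) = (\<Prod>i\<in>A. f (g i))"
  using assms f by (induction A rule: infinite_finite_induct)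
    (auto simp: partial_hom_def subring_on_prod[OF R])

lemma partial_hom_uminus: "x \<in> R \<Longrightarrow> f (- x) = - f x"
  using f subring_onD(5)[OF R, of x] unfolding partial_hom_def
  by (metis add.right_inverse eq_neg_iff_add_eq_0 add.commute)

lemma partial_hom_diff: "x \<in> R \<Longrightarrow> y \<in> R \<Longrightarrow> f (x - y) = f x - f y"
  using f partial_hom_uminus[of y] subring_onD(5)[OF R, of y] unfolding partial_hom_def
  by (metis diff_conv_add_uminus)

lemma map_poly_partial_hom_add:
  "p \<in> polys_over R \<Longrightarrow> q \<in> polys_over R \<Longrightarrow> map_poly f (p + q) = map_poly f p + map_poly f q"
  using f by (intro poly_eqI) (auto simp: coeff_map_poly partial_hom_def polys_over_def)

lemma map_poly_partial_hom_diff: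
  "p \<in> polys_over R \<Longrightarrow> q \<in> polys_over R \<Longrightarrow> map_poly f (p - q) = map_poly f p - map_poly f q"
  using f by (intro poly_eqI) (auto simp: coeff_map_poly partial_hom_def polys_over_def partial_hom_diff)

lemma map_poly_partial_hom_mult:
  assumes "p \<in> polys_over R" "q \<in> polys_over R"
  shows "map_poly f (p * q) = map_poly f p * map_poly f q"
proof (rule poly_eqI)
  fix n
  have in_R: "coeff p i \<in> R" "coeff q i \<in> R" for i using assms by (auto simp: polys_over_def)
  show "coeff (map_poly f (p * q)) n = coeff (map_poly f p * map_poly f q) n"
    using f in_R subring_onD(4)[OF R]
    by (simp add: coeff_map_poly partial_hom_def coeff_mult partial_hom_sum)
qed

text \<open>Universal property of the extension: \<open>x\<close> may be sent to any
  \<open>y\<close> that satisfies the images of all relations of \<open>x\<close> over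
  \<open>R\<close>.\<close>

lemma partial_hom_extend:
  assumes vanish: "\<And>p. p \<in> polys_over R \<Longrightarrow> poly p x = 0 \<Longrightarrow> poly (map_poly f p) y = 0"
  obtains g where "partial_hom (adjoin R x) g"
    "\<And>p. p \<in> polys_over R \<Longrightarrow> g (poly p x) = poly (map_poly f p) y"
proof -
  have eq: "poly (map_poly f p) y = poly (map_poly f q) y"
    if "p \<in> polys_over R" "q \<in> polys_over R" "poly p x = poly q x" for p q
    using vanish[of "p - q"] that by (auto simp: polys_over_diff_subring[OF R] map_poly_partial_hom_diff)
  \<comment> \<open>The choice of a representing polynomial is harmless by
    \<open>eq\<close>.\<close>
  define g where "g w = poly (map_poly f (SOME p. p \<in> polys_over R \<and> poly p x = w)) y" for w
  have g: "g (poly p x) = poly (map_poly f p) y" if "p \<in> polys_over R" for p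
  proof -
    have "(SOME q. q \<in> polys_over R \<and> poly q x = poly p x) \<in> polys_over R \<and>
      poly (SOME q. q \<in> polys_over R \<and> poly q x = poly p x) x = poly p x"
      by (rule someI[of _ p]) (use that in auto)
    then show ?thesis unfolding g_def by (intro eq that) auto
  qed
  have "partial_hom (adjoin R x) g"
    unfolding partial_hom_def
  proof (intro conjI ballI)
    show "g 0 = 0" using g[of 0] polys_over_0_subring[OF R] by simp
    have "map_poly f [:1:] = [:1:]" using f by (intro poly_eqI) (auto simp: coeff_map_poly partial_hom_def coeff_pCons split: nat.split)
    then show "g 1 = 1" using g[of "[:1:]"] polys_over_const_subring[OF R] subring_onD[OF R] by simp
  next
    fix u v assume "u \<in> adjoin R x" "v \<in> adjoin R x"
    then obtain p q where pq: "p \<in> polys_over R" "u = poly p x" "q \<in> polys_over R" "v = poly q x"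
      by (auto simp: adjoin_def)
    have "g (poly (p + q) x) = g (poly p x) + g (poly q x)"
      using pq g polys_over_subring_intros[OF R] by (simp add: map_poly_partial_hom_add del: poly_add) simp
    moreover have "g (poly (p * q) x) = g (poly p x) * g (poly q x)"
      using pq g polys_over_subring_intros[OF R] by (simp add: map_poly_partial_hom_mult del: poly_mult) simp
    ultimately show "g (u + v) = g u + g v" "g (u * v) = g u * g v" using pq by simp_all
  qed
  then show ?thesis using that g by blast
qed

end

text \<open>The non-vanishing clause is what lets the property pass to \<open>adjoin R x\<close>.\<close>

definition specializable :: "complex set \<Rightarrow> complex set \<Rightarrow> bool"
  where "specializable L R \<longleftrightarrow> subring_on R \<and> L \<subseteq> R \<and>
    (\<forall>d\<in>R. d \<noteq> 0 \<longrightarrow> (\<exists>f. partial_hom R f \<and> f ` R \<subseteq> L \<and> (\<forall>x\<in>L. f x = x) \<and> f d \<noteq> 0))"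

text \<open>A least-degree argument in place of a resultant: among the polynomials whose value at
  \<open>x\<close> is a nonzero multiple of \<open>d\<close>, one of least degree is constant. Its
  value \<open>c\<close> allows non-vanishing at \<open>d\<close> to be controlled inside
  \<open>R\<close>.\<close>

lemma nonzero_multiple_in_base:
  assumes R: "subring_on R" and p: "p \<in> polys_over R" "p \<noteq> 0" "poly p x = 0"
    and minimal: "\<And>q. q \<in> polys_over R \<Longrightarrow> poly q x = 0 \<Longrightarrow> q \<noteq> 0 \<Longrightarrow> degree p \<le> degree q"
    and d: "d \<in> adjoin R x" "d \<noteq> 0"
  obtains c u where "c \<in> R" "c \<noteq> 0" "u \<in> adjoin R x" "c = d * u"
proof -
  define S where "S = {h \<in> polys_over R. poly h x \<noteq> 0 \<and> (\<exists>u\<in>adjoin R x. poly h x = d * u)}"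
  note sub = subring_on_adjoin[OF R, of x]
  have in_adj: "poly q x \<in> adjoin R x" if "q \<in> polys_over R" for q
    using that by (auto simp: adjoin_def)
  have lead: "lead_coeff q \<in> R" if "q \<in> polys_over R" for q using that by (auto simp: polys_over_def)
  obtain q where "q \<in> polys_over R" "d = poly q x" using d by (auto simp: adjoin_def)
  then have "q \<in> S" using d subring_onD(2)[OF sub] by (auto simp: S_def intro!: bexI[of _ 1])
  then obtain h where h: "h \<in> S" and h_min: "\<And>q. q \<in> S \<Longrightarrow> degree h \<le> degree q"
    using exists_least_iff[of "\<lambda>n. \<exists>h\<in>S. degree h = n"] by (metis not_le)
  then obtain u where hu: "h \<in> polys_over R" "poly h x \<noteq> 0" "u \<in> adjoin R x" "poly h x = d * u"
    by (auto simp: S_def)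
  then have "h \<noteq> 0" by auto
  \<comment> \<open>Otherwise the remainder of \<open>h\<close> modulo \<open>p\<close> would be a
    member of \<open>S\<close> of smaller degree.\<close>
  have "degree h < degree p"
  proof (rule ccontr)
    assume "\<not> degree h < degree p"
    from pseudo_division_over[OF R p(1,2) hu(1)] obtain N k g where
      g: "g \<in> polys_over R" "smult (lead_coeff p ^ N) h = p * k + g" "g = 0 \<or> degree g < degree p" by blast
    have "poly g x = lead_coeff p ^ N * poly h x" using arg_cong[OF g(2), of "\<lambda>q. poly q x"] p(3) by simp
    then have "poly g x \<noteq> 0" "poly g x = d * (lead_coeff p ^ N * u)" using hu p(2) by auto
    moreover have "lead_coeff p ^ N * u \<in> adjoin R x"
      using subset_adjoin[OF R, of x] lead[OF p(1)] hu
      by (intro subring_onD(4)[OF sub] subring_on_power[OF sub]) auto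
    ultimately have "g \<in> S" using g(1) by (auto simp: S_def)
    then have "degree h \<le> degree g" "g \<noteq> 0" using h_min \<open>poly g x \<noteq> 0\<close> by auto
    then show False using g(3) \<open>\<not> degree h < degree p\<close> by auto
  qed
  \<comment> \<open>Divide \<open>p\<close> by \<open>h\<close>. The value of the remainder at
    \<open>x\<close> is again a multiple of \<open>d\<close>, so it is 0 by the choice of
    \<open>h\<close>, and the remainder itself is 0 by the choice of \<open>p\<close>. The quotient
    would then be a relation of degree below that of \<open>p\<close>.\<close>
  have "degree h = 0"
  proof (rule ccontr)
    assume pos: "degree h \<noteq> 0"
    from pseudo_division_over[OF R hu(1) \<open>h \<noteq> 0\<close> p(1)] obtain N k g where
      g: "k \<in> polys_over R" "g \<in> polys_over R" "smult (lead_coeff h ^ N) p = h * k + g" "g = 0 \<or> degree g < degree h" by blast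
    have gx: "poly g x = d * (- u * poly k x)"
      using arg_cong[OF g(3), of "\<lambda>q. poly q x"] p(3) hu by (simp add: add_eq_0_iff)
    have "- u * poly k x \<in> adjoin R x"
      using hu in_adj[OF g(1)] by (intro subring_onD(4)[OF sub] subring_onD(5)[OF sub]) auto
    then have "poly g x = 0"
    proof (rule_tac ccontr)
      assume "poly g x \<noteq> 0"
      then have "g \<in> S" unfolding S_def using gx g(2) \<open>- u * poly k x \<in> adjoin R x\<close> by blast
      then show False using h_min[of g] g(4) \<open>poly g x \<noteq> 0\<close> by auto
    qed
    then have "g = 0" using minimal[OF g(2)] g(4) \<open>degree h < degree p\<close> by fastforce
    have "poly k x = 0" using \<open>poly g x = 0\<close> gx d hu by auto
    have hk: "smult (lead_coeff h ^ N) p = h * k" using g(3) \<open>g = 0\<close> by simp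
    then have "k \<noteq> 0" using p(2) \<open>h \<noteq> 0\<close> by auto
    have "degree p = degree h + degree k"
      using arg_cong[OF hk, of degree] \<open>h \<noteq> 0\<close> \<open>k \<noteq> 0\<close> by (simp add: degree_mult_eq)
    then show False using minimal[OF g(1) \<open>poly k x = 0\<close> \<open>k \<noteq> 0\<close>] pos by simp
  qed
  then obtain c where "h = [:c:]" by (auto elim: degree_eq_zeroE)
  then show ?thesis using that[of c u] hu lead[OF hu(1)] by auto
qed

text \<open>If \<open>x\<close> is transcendental over \<open>R\<close>, its image can be almost any
  element of \<open>L\<close>; if it is algebraic, the image must be a root of the transported
  minimal relation, and \<open>nonzero_multiple_in_base\<close> protects \<open>d\<close>.\<close>

lemma specializable_adjoin:
  assumes L: "alg_closed_subfield L" and spec: "specializable L R"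
  shows "specializable L (adjoin R x)"
proof -
  have R: "subring_on R" and LR: "L \<subseteq> R" using spec by (auto simp: specializable_def)
  have subL: "subring_on L" using L by (auto simp: alg_closed_subfield_def intro: complex_subfield_imp_subring_on)
  have infL: "infinite L"
  proof -
    have "range of_nat \<subseteq> L" using subring_on_of_nat[OF subL] by blast
    moreover have "infinite (range (of_nat :: nat \<Rightarrow> complex))"
      by (rule range_inj_infinite) (simp add: inj_on_def)
    ultimately show ?thesis using infinite_super by blast
  qed
  have map_L: "map_poly f p \<in> polys_over L" if "p \<in> polys_over R" "f ` R \<subseteq> L" "partial_hom R f" for f p
    using that by (auto simp: polys_over_def coeff_map_poly partial_hom_def)
  have ext: "\<exists>g. partial_hom (adjoin R x) g \<and> g ` adjoin R x \<subseteq> L \<and> (\<forall>x\<in>L. g x = x) \<and>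
      (\<forall>p\<in>polys_over R. g (poly p x) = poly (map_poly f p) y)"
    if f: "partial_hom R f" "f ` R \<subseteq> L" "\<forall>x\<in>L. f x = x" and y: "y \<in> L"
      and vanish: "\<And>p. p \<in> polys_over R \<Longrightarrow> poly p x = 0 \<Longrightarrow> poly (map_poly f p) y = 0" for f y
  proof -
    obtain g where g: "partial_hom (adjoin R x) g"
      "\<And>p. p \<in> polys_over R \<Longrightarrow> g (poly p x) = poly (map_poly f p) y"
      using partial_hom_extend[OF R f(1) vanish] by blast
    have "g c = c" if "c \<in> L" for c
    proof -
      have "map_poly f [:c:] = [:f c:]" using f
        by (intro poly_eqI) (auto simp: coeff_map_poly partial_hom_def coeff_pCons split: nat.split)
      then show ?thesis using g(2)[of "[:c:]"] that LR f(3) polys_over_const_subring[OF R, of c] by auto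
    qed
    moreover have "g ` adjoin R x \<subseteq> L"
      using g(2) poly_in_subring[OF subL map_L y] f by (auto simp: adjoin_def)
    ultimately show ?thesis using g by blast
  qed
  have "\<exists>g. partial_hom (adjoin R x) g \<and> g ` adjoin R x \<subseteq> L \<and> (\<forall>x\<in>L. g x = x) \<and> g d \<noteq> 0"
    if d: "d \<in> adjoin R x" "d \<noteq> 0" for d
  proof (cases "\<exists>p\<in>polys_over R. p \<noteq> 0 \<and> poly p x = 0")
    \<comment> \<open>There are no relations to respect. Keeping the leading coefficient of
      \<open>q\<close> nonzero leaves only finitely many forbidden images, and \<open>L\<close> is
      infinite.\<close>
    case False
    obtain q where q: "q \<in> polys_over R" "d = poly q x" using d by (auto simp: adjoin_def)
    then have "lead_coeff q \<noteq> 0" "lead_coeff q \<in> R" using d by (auto simp: polys_over_def)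
    then obtain f where f: "partial_hom R f" "f ` R \<subseteq> L" "\<forall>x\<in>L. f x = x" "f (lead_coeff q) \<noteq> 0"
      using spec by (auto simp: specializable_def)
    have "coeff (map_poly f q) (degree q) \<noteq> 0" using f by (simp add: coeff_map_poly partial_hom_def)
    then have "map_poly f q \<noteq> 0" by force
    then have "finite {y. poly (map_poly f q) y = 0}" by (rule poly_roots_finite)
    then obtain y where y: "y \<in> L" "poly (map_poly f q) y \<noteq> 0"
      using infL by (metis (mono_tags) finite_subset mem_Collect_eq subsetI)
    have "poly (map_poly f p) y = 0" if "p \<in> polys_over R" "poly p x = 0" for p
      using False that by fastforce
    from ext[OF f(1-3) y(1) this] show ?thesis using q y(2) by auto
  next
    case True
    then obtain p where p: "p \<in> polys_over R" "p \<noteq> 0" "poly p x = 0"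
      and p_min: "\<And>q. q \<in> polys_over R \<Longrightarrow> poly q x = 0 \<Longrightarrow> q \<noteq> 0 \<Longrightarrow> degree p \<le> degree q"
      using exists_least_iff[of "\<lambda>n. \<exists>p\<in>polys_over R. p \<noteq> 0 \<and> poly p x = 0 \<and> degree p = n"] by (metis not_le)
    have deg: "degree p > 0" using p by (auto intro!: Nat.gr0I elim!: degree_eq_zeroE)
    obtain c u where c: "c \<in> R" "c \<noteq> 0" "u \<in> adjoin R x" "c = d * u"
      using nonzero_multiple_in_base[OF R p p_min d] by blast
    \<comment> \<open>One homomorphism must serve two purposes: a nonzero image of \<open>c\<close>
      forces a nonzero image of its divisor \<open>d\<close>, and a nonzero image of the leading
      coefficient keeps the degree of \<open>p\<close> positive and can later be cancelled.\<close>
    have "lead_coeff p \<in> R" using p by (auto simp: polys_over_def)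
    then have "c * lead_coeff p \<in> R" "c * lead_coeff p \<noteq> 0" using c p subring_onD(4)[OF R] by auto
    then obtain f where f: "partial_hom R f" "f ` R \<subseteq> L" "\<forall>x\<in>L. f x = x" "f (c * lead_coeff p) \<noteq> 0"
      using spec by (auto simp: specializable_def)
    have fm: "f (c * lead_coeff p) = f c * f (lead_coeff p)" using f(1) c \<open>lead_coeff p \<in> R\<close> by (auto simp: partial_hom_def)
    have nz: "f c \<noteq> 0" "f (lead_coeff p) \<noteq> 0" using f(4) fm by auto
    have deg': "degree (map_poly f p) \<ge> degree p"
      using nz(2) f(1) by (intro le_degree) (simp add: coeff_map_poly partial_hom_def)
    then obtain y where y: "y \<in> L" "poly (map_poly f p) y = 0"
      using L map_L[OF p(1) f(2,1)] deg by (auto simp: alg_closed_subfield_def)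
    \<comment> \<open>By minimality of \<open>p\<close>, every relation is a multiple of
      \<open>p\<close> up to a power of the leading coefficient, whose image is nonzero.\<close>
    have vanish: "poly (map_poly f q) y = 0" if q: "q \<in> polys_over R" "poly q x = 0" for q
    proof -
      from pseudo_division_over[OF R p(1,2) q(1)] obtain N k g where
        g: "k \<in> polys_over R" "g \<in> polys_over R" "smult (lead_coeff p ^ N) q = p * k + g" "g = 0 \<or> degree g < degree p" by blast
      have "poly g x = 0" using arg_cong[OF g(3), of "\<lambda>q. poly q x"] p(3) q(2) by simp
      then have "g = 0" using p_min[OF g(2)] g(4) by fastforce
      define r where "r = lead_coeff p ^ N"
      have r: "r \<in> R" using \<open>lead_coeff p \<in> R\<close> subring_on_power[OF R] by (simp add: r_def)
      have fr: "f r = f (lead_coeff p) ^ N" unfolding r_def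
        using partial_hom_prod[OF R f(1), of "{..<N}" "\<lambda>_. lead_coeff p"] \<open>lead_coeff p \<in> R\<close> by simp
      have "[:r:] * q = p * k" using g(3) \<open>g = 0\<close> by (simp add: r_def)
      then have "map_poly f [:r:] * map_poly f q = map_poly f p * map_poly f k"
        using map_poly_partial_hom_mult[OF R f(1)] polys_over_const_subring[OF R r] q(1) p(1) g(1) by metis
      moreover have "map_poly f [:r:] = [:f r:]" using f
        by (intro poly_eqI) (auto simp: coeff_map_poly partial_hom_def coeff_pCons split: nat.split)
      ultimately have "f r * poly (map_poly f q) y = 0"
        using y(2) 
        by (metis (no_types, lifting) mult_zero_left mult_zero_right add_0_right poly_pCons poly_0 poly_mult)
      then show ?thesis using fr nz by simp
    qed
    obtain g where g: "partial_hom (adjoin R x) g" "g ` adjoin R x \<subseteq> L" "\<forall>x\<in>L. g x = x"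
      "\<forall>p\<in>polys_over R. g (poly p x) = poly (map_poly f p) y" using ext[OF f(1-3) y(1) vanish] by blast
    have "map_poly f [:c:] = [:f c:]" using f
      by (intro poly_eqI) (auto simp: coeff_map_poly partial_hom_def coeff_pCons split: nat.split)
    then have "g c = f c" using g(4)[rule_format, of "[:c:]"] polys_over_const_subring[OF R c(1)] by simp
    moreover have "g c = g d * g u" using g(1) c d(1) by (auto simp: partial_hom_def)
    ultimately have "g d \<noteq> 0" using nz by auto
    then show ?thesis using g by blast
  qed
  then show ?thesis unfolding specializable_def
    using subring_on_adjoin[OF R] subset_adjoin[OF R] LR by blast
qed

text \<open>The tower of extensions starts with \<open>L\<close> itself, specialized by the
  identity.\<close>

lemma specializable_contains:
  assumes L: "alg_closed_subfield L" and "finite X"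
  shows "\<exists>R. specializable L R \<and> X \<subseteq> R"
  using assms(2)
proof (induction X)
  case empty
  have "subring_on L" using L by (auto simp: alg_closed_subfield_def intro: complex_subfield_imp_subring_on)
  then have "specializable L L" by (auto simp: specializable_def partial_hom_def intro!: exI[of _ id])
  then show ?case by blast
next
  case (insert x X)
  then obtain R where R: "specializable L R" "X \<subseteq> R" by blast
  then have "subring_on R" by (auto simp: specializable_def)
  then have "insert x X \<subseteq> adjoin R x" using R(2) subset_adjoin mem_adjoin by blast
  then show ?case using specializable_adjoin[OF L R(1)] by blast
qed

section \<open>Weighted power sums and a Newton step\<close>

text \<open>Linearity in \<open>p\<close>; the constant term has to vanish because the given power
  sums start with exponent 1.\<close>

lemma power_sum_poly:
  fixes w c :: "nat \<Rightarrow> complex"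
  assumes "\<And>s. s < n \<Longrightarrow> (\<Sum>j\<in>J. w j * c j ^ Suc s) = 0" "degree p \<le> n" "poly p 0 = 0"
  shows "(\<Sum>j\<in>J. w j * poly p (c j)) = 0"
proof -
  have "(\<Sum>j\<in>J. w j * poly p (c j)) = (\<Sum>j\<in>J. \<Sum>i\<le>degree p. w j * (coeff p i * c j ^ i))"
    by (simp add: poly_altdef sum_distrib_left)
  also have "\<dots> = (\<Sum>i\<le>degree p. \<Sum>j\<in>J. w j * (coeff p i * c j ^ i))"
    by (rule sum.swap)
  also have "\<dots> = (\<Sum>i\<le>degree p. coeff p i * (\<Sum>j\<in>J. w j * c j ^ i))"
    by (simp add: sum_distrib_left mult_ac)
  also have "\<dots> = 0"
  proof (intro sum.neutral ballI)
    fix i assume "i \<in> {..degree p}"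
    then show "coeff p i * (\<Sum>j\<in>J. w j * c j ^ i) = 0"
      using assms by (cases i) (auto simp: poly_0_coeff_0)
  qed
  finally show ?thesis .
qed

text \<open>A polynomial of degree at most \<open>B\<close> without constant term can isolate one
  nonzero value if there are at most \<open>B\<close> such values. It would show that the total
  weight at this value is 0, against positivity.\<close>

lemma power_sums_zero_imp_inj:
  fixes c :: "nat \<Rightarrow> complex" and w :: "nat \<Rightarrow> real"
  assumes w: "\<And>j. j \<le> B \<Longrightarrow> w j > 0"
    and sums: "\<And>s. s < B \<Longrightarrow> (\<Sum>j\<le>B. of_real (w j) * c j ^ Suc s) = 0"
    and nz: "i \<le> B" "c i \<noteq> 0"
  shows "inj_on c {..B} \<and> (\<forall>j\<le>B. c j \<noteq> 0)"
proof (rule ccontr)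
  assume bad: "\<not> ?thesis"
  \<comment> \<open>Of the \<open>B + 1\<close> entries, a repetition or a zero leaves at most
    \<open>B\<close> distinct nonzero values.\<close>
  define V where "V = c ` {..B} - {0}"
  have "card V \<le> B"
  proof (cases "inj_on c {..B}")
    case True
    with bad have "0 \<in> c ` {..B}" by force
    then have "card V = card (c ` {..B}) - 1" by (simp add: V_def)
    also have "\<dots> = B" using card_image[OF True] by simp
    finally show ?thesis by simp
  next
    case False
    then have "card (c ` {..B}) \<noteq> Suc B" using eq_card_imp_inj_on[of "{..B}" c] by auto
    moreover have "card (c ` {..B}) \<le> Suc B" using card_image_le[of "{..B}" c] by simp
    moreover have "card V \<le> card (c ` {..B})" by (intro card_mono) (auto simp: V_def)
    ultimately show ?thesis by simp
  qed
  have v: "c i \<in> V" "finite V" using nz by (auto simp: V_def)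
  \<comment> \<open>It vanishes at 0 and at every other nonzero value, so only the entries equal to
    \<open>c i\<close> survive in the sum.\<close>
  define p where "p = [:0, 1:] * (\<Prod>u\<in>V - {c i}. [:- u, 1:])"
  have "degree p \<le> Suc (degree (\<Prod>u\<in>V - {c i}. [:- u, 1:]))"
    unfolding p_def by (rule order.trans[OF degree_mult_le]) simp
  also have "\<dots> \<le> Suc (card (V - {c i}))"
    using degree_prod_sum_le[of "V - {c i}" "\<lambda>u. [:- u, 1:]"] v by simp
  also have "\<dots> \<le> B" using v \<open>card V \<le> B\<close> card_Suc_Diff1[OF v(2,1)] by simp
  finally have "(\<Sum>j\<le>B. of_real (w j) * poly p (c j)) = 0"
    by (intro power_sum_poly[of B]) (use sums in \<open>auto simp: p_def\<close>)
  moreover have "(\<Sum>j\<le>B. of_real (w j) * poly p (c j)) = (\<Sum>j | j \<le> B \<and> c j = c i. of_real (w j) * poly p (c i))"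
    using v by (intro sum.mono_neutral_cong_right) (auto simp: p_def poly_prod V_def)
  moreover have "poly p (c i) \<noteq> 0" using nz v by (auto simp: p_def poly_prod)
  ultimately have "complex_of_real (\<Sum>j | j \<le> B \<and> c j = c i. w j) = 0"
    by (simp add: sum_distrib_right[symmetric])
  then have "(\<Sum>j | j \<le> B \<and> c j = c i. w j) = 0" by (simp only: of_real_eq_0_iff)
  moreover have "(\<Sum>j | j \<le> B \<and> c j = c i. w j) > 0" using nz w by (intro sum_pos) auto
  ultimately show False by simp
qed

text \<open>The coefficients of the Lagrange basis polynomials form the inverse matrix:
  interpolating the monomial of degree \<open>s\<close> at \<open>B + 1\<close> nodes returns that
  monomial, and coefficients are compared.\<close>

lemma vandermonde_inverse:
  fixes c :: "nat \<Rightarrow> complex"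
  assumes inj: "inj_on c {..B}"
  obtains L where "\<And>s s'. s \<le> B \<Longrightarrow> s' \<le> B \<Longrightarrow> (\<Sum>j\<le>B. c j ^ s * L j s') = (if s = s' then 1 else 0)"
proof
  define l where "l j = smult (inverse (\<Prod>i\<in>{..B} - {j}. c j - c i)) (\<Prod>i\<in>{..B} - {j}. [:- c i, 1:])" for j
  have deg: "degree (l j) \<le> B" if "j \<le> B" for j
    using degree_prod_sum_le[of "{..B} - {j}" "\<lambda>i. [:- c i, 1:]"] that by (simp add: l_def)
  have val: "poly (l j) (c i) = (if i = j then 1 else 0)" if "i \<le> B" "j \<le> B" for i j
  proof -
    have "(\<Prod>i\<in>{..B} - {j}. c j - c i) \<noteq> 0" using that inj by (auto simp: inj_on_def)
    moreover have "(\<Prod>k\<in>{..B} - {j}. c i - c k) = 0" if "i \<noteq> j" using \<open>i \<le> B\<close> that by (auto intro!: prod_zero)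
    ultimately show ?thesis by (auto simp: l_def poly_prod)
  qed
  fix s s' assume s: "s \<le> B" "s' \<le> B"
  have "(\<Sum>j\<le>B. smult (c j ^ s) (l j)) = monom 1 s"
  proof (rule poly_eqI_degree[of "c ` {..B}"])
    fix x assume "x \<in> c ` {..B}"
    then obtain i where "i \<le> B" "x = c i" by auto
    have "poly (\<Sum>j\<le>B. smult (c j ^ s) (l j)) x = (\<Sum>j\<le>B. if i = j then c j ^ s else 0)"
      unfolding poly_sum \<open>x = c i\<close> using \<open>i \<le> B\<close> by (intro sum.cong) (auto simp: val)
    then show "poly (\<Sum>j\<le>B. smult (c j ^ s) (l j)) x = poly (monom 1 s) x"
      using \<open>i \<le> B\<close> \<open>x = c i\<close> by (simp add: poly_monom)
  next
    have "degree (\<Sum>j\<le>B. smult (c j ^ s) (l j)) \<le> B"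
      by (intro degree_sum_le) (auto intro: order.trans[OF degree_smult_le] deg)
    then show "degree (\<Sum>j\<le>B. smult (c j ^ s) (l j)) < card (c ` {..B})"
      by (simp add: card_image[OF inj])
    show "degree (monom (1::complex) s) < card (c ` {..B})"
      using s by (simp add: card_image[OF inj] degree_monom_eq)
  qed
  from arg_cong[OF this, of "\<lambda>p. coeff p s'"]
  show "(\<Sum>j\<le>B. c j ^ s * coeff (l j) s') = (if s = s' then 1 else 0)"
    by (simp add: coeff_sum)
qed

text \<open>Tychonoff's theorem. Every coordinate is confined, also those beyond the finitely many
  in use, since the space consists of all functions on the naturals.\<close>

lemma compact_box: "compact {c :: nat \<Rightarrow> complex. \<forall>j. c j \<in> cball (a j) (r j)}"
proof -
  have "{c. \<forall>j. c j \<in> cball (a j) (r j)} = (\<Pi>\<^sub>E j\<in>UNIV. cball (a j) (r j))"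
    by (auto simp: PiE_def Pi_def)
  moreover have "compactin (product_topology (\<lambda>_. euclidean) UNIV) (\<Pi>\<^sub>E j\<in>UNIV. cball (a j) (r j))"
    by (subst compactin_PiE) simp
  ultimately show ?thesis by (simp add: euclidean_product_topology)
qed

text \<open>Penalising the distance to the starting point keeps the minimiser, and one Newton step from
  it, inside the box; that step would decrease the functional unless the minimiser is a zero.\<close>

lemma approximate_newton_zero:
  fixes F :: "'i \<Rightarrow> (nat \<Rightarrow> complex) \<Rightarrow> complex" and c0 :: "nat \<Rightarrow> complex"
  assumes fin: "finite I" "finite J" and r: "r > 0" and C: "C > 0"
  defines "X \<equiv> {c. \<forall>j. c j \<in> cball (c0 j) r}"
  assumes cont: "\<And>s. s \<in> I \<Longrightarrow> continuous_on X (F s)"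
    and diff: "\<And>s c c'. s \<in> I \<Longrightarrow> c \<in> X \<Longrightarrow> c' \<in> X \<Longrightarrow> F s c' - F s c = (\<Sum>j\<in>J. H s j c c' * (c' j - c j))"
    and close: "\<And>s j c c'. s \<in> I \<Longrightarrow> j \<in> J \<Longrightarrow> c \<in> X \<Longrightarrow> c' \<in> X \<Longrightarrow> norm (H s j c c' - D s j) \<le> \<epsilon>"
    and inv: "\<And>s s'. s \<in> I \<Longrightarrow> s' \<in> I \<Longrightarrow> (\<Sum>j\<in>J. D s j * A j s') = (if s = s' then 1 else 0)"
    and A: "\<And>s. s \<in> I \<Longrightarrow> (\<Sum>j\<in>J. norm (A j s)) \<le> C"
    and \<epsilon>: "\<epsilon> * C * card I \<le> 1 / 2" "\<epsilon> \<ge> 0"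
    and start: "5 * C * (\<Sum>s\<in>I. norm (F s c0)) \<le> r"
  shows "\<exists>c\<in>X. \<forall>s\<in>I. F s c = 0"
proof -
  define N where "N c = (\<Sum>s\<in>I. norm (F s c))" for c
  define P where "P c = (\<Sum>j\<in>J. norm (c j - c0 j))" for c
  \<comment> \<open>The factor \<open>1 / (4 * C)\<close> balances the two effects of a Newton step:
    it halves \<open>N\<close> and raises the penalty by at most \<open>N c / 4\<close>, so the
    functional drops unless \<open>N c = 0\<close>.\<close>
  define \<Phi> where "\<Phi> c = N c + P c / (4 * C)" for c
  have "compact X" unfolding X_def by (rule compact_box)
  moreover have c0: "c0 \<in> X" using r by (auto simp: X_def)
  moreover have "continuous_on X \<Phi>"
    unfolding \<Phi>_def N_def P_def
    using C continuous_on_subset[OF continuous_on_product_coordinates subset_UNIV]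
    by (intro continuous_on_add continuous_on_sum continuous_on_norm continuous_on_divide
        continuous_on_diff continuous_on_const cont) auto
  ultimately obtain c where c: "c \<in> X" and min: "\<And>y. y \<in> X \<Longrightarrow> \<Phi> c \<le> \<Phi> y"
    using continuous_attains_inf[of X \<Phi>] by auto
  have N0: "N x \<ge> 0" for x by (auto simp: N_def sum_nonneg)
  have P0: "P x \<ge> 0" for x by (auto simp: P_def sum_nonneg)
  have "\<Phi> c \<le> N c0" using min[OF c0] by (simp add: \<Phi>_def P_def)
  moreover have "P c / (4 * C) \<ge> 0" using P0 C by simp
  ultimately have Nc: "N c \<le> N c0" and "P c / (4 * C) \<le> N c0"
    using N0[of c] unfolding \<Phi>_def by linarith+
  then have Pc: "P c \<le> 4 * C * N c0" using C by (simp add: field_simps)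
  \<comment> \<open>A Newton step with the fixed right inverse \<open>A\<close> of the approximate
    Jacobian \<open>D\<close>; coordinates outside \<open>J\<close> stay put.\<close>
  define c' where "c' j = (if j \<in> J then c j - (\<Sum>s\<in>I. A j s * F s c) else c j)" for j
  have step: "(\<Sum>j\<in>J. norm (c' j - c j)) \<le> C * N c"
  proof -
    have "(\<Sum>j\<in>J. norm (c' j - c j)) \<le> (\<Sum>j\<in>J. \<Sum>s\<in>I. norm (A j s) * norm (F s c))"
      by (intro sum_mono) (auto simp: c'_def norm_mult[symmetric] intro: norm_sum)
    also have "\<dots> = (\<Sum>s\<in>I. (\<Sum>j\<in>J. norm (A j s)) * norm (F s c))"
      by (subst sum.swap) (simp add: sum_distrib_right)
    also have "\<dots> \<le> (\<Sum>s\<in>I. C * norm (F s c))"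
      by (intro sum_mono mult_right_mono A) auto
    finally show ?thesis by (simp add: N_def sum_distrib_left)
  qed
  \<comment> \<open>This accounts for the constant 5 in the starting condition: the minimiser is
    within \<open>4 * C * N c0\<close> of the start, and the step adds at most
    \<open>C * N c0\<close>.\<close>
  have "c' \<in> X"
    unfolding X_def
  proof (intro CollectI allI)
    fix j
    show "c' j \<in> cball (c0 j) r"
    proof (cases "j \<in> J")
      case True
      have "norm (c' j - c0 j) \<le> norm (c' j - c j) + norm (c j - c0 j)"
        using norm_triangle_ineq[of "c' j - c j" "c j - c0 j"] by simp
      also have "norm (c' j - c j) \<le> (\<Sum>j\<in>J. norm (c' j - c j))"
        using True fin by (intro member_le_sum) auto
      also note step
      also have "norm (c j - c0 j) \<le> P c"
        unfolding P_def using True fin by (intro member_le_sum) auto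
      also note Pc
      also have "C * N c \<le> C * N c0" using Nc C by simp
      finally show ?thesis using start by (simp add: N_def dist_norm norm_minus_commute)
    qed (use c in \<open>auto simp: c'_def X_def\<close>)
  qed
  \<comment> \<open>The linear parts cancel since \<open>A\<close> is a right inverse of
    \<open>D\<close>; what remains is the deviation of the secant matrix \<open>H\<close> from
    \<open>D\<close>.\<close>
  have new: "F s c' = (\<Sum>s'\<in>I. (\<Sum>j\<in>J. (D s j - H s j c c') * A j s') * F s' c)" if s: "s \<in> I" for s
  proof -
    have "F s c' = F s c + (\<Sum>j\<in>J. H s j c c' * (c' j - c j))"
      using diff[OF s c \<open>c' \<in> X\<close>] by (simp add: algebra_simps)
    also have "(\<Sum>j\<in>J. H s j c c' * (c' j - c j)) = - (\<Sum>j\<in>J. \<Sum>s'\<in>I. H s j c c' * A j s' * F s' c)"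
      by (simp add: c'_def sum_distrib_left mult.assoc sum_negf[symmetric])
    also have "(\<Sum>j\<in>J. \<Sum>s'\<in>I. H s j c c' * A j s' * F s' c) = (\<Sum>s'\<in>I. (\<Sum>j\<in>J. H s j c c' * A j s') * F s' c)"
      by (subst sum.swap) (simp add: sum_distrib_right)
    also have "F s c = (\<Sum>s'\<in>I. (if s = s' then 1 else 0) * F s' c)"
      using s fin by (subst sum.cong[OF refl, of _ _ "\<lambda>s'. if s = s' then F s' c else 0"]) auto
    also have "\<dots> = (\<Sum>s'\<in>I. (\<Sum>j\<in>J. D s j * A j s') * F s' c)"
      by (intro sum.cong refl) (simp add: inv s)
    finally show ?thesis
      by (simp add: sum_subtractf algebra_simps)
  qed
  have "norm (F s c') \<le> \<epsilon> * C * N c" if s: "s \<in> I" for s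
  proof -
    have "norm (F s c') \<le> (\<Sum>s'\<in>I. norm (\<Sum>j\<in>J. (D s j - H s j c c') * A j s') * norm (F s' c))"
      unfolding new[OF s] norm_mult[symmetric] by (rule norm_sum)
    also have "\<dots> \<le> (\<Sum>s'\<in>I. (\<epsilon> * C) * norm (F s' c))"
    proof (intro sum_mono mult_right_mono)
      fix s' assume s': "s' \<in> I"
      have "norm (\<Sum>j\<in>J. (D s j - H s j c c') * A j s') \<le> (\<Sum>j\<in>J. norm (D s j - H s j c c') * norm (A j s'))"
        by (auto simp: norm_mult[symmetric] intro: norm_sum)
      also have "\<dots> \<le> (\<Sum>j\<in>J. \<epsilon> * norm (A j s'))"
        using close[OF s _ c \<open>c' \<in> X\<close>] by (intro sum_mono mult_right_mono) (auto simp: norm_minus_commute)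
      also have "\<dots> \<le> \<epsilon> * C" using A[OF s'] \<epsilon>(2) by (simp add: sum_distrib_left[symmetric] mult_left_mono)
      finally show "norm (\<Sum>j\<in>J. (D s j - H s j c c') * A j s') \<le> \<epsilon> * C" .
    qed auto
    finally show ?thesis by (simp add: N_def sum_distrib_left)
  qed
  then have "N c' \<le> (\<Sum>s\<in>I. \<epsilon> * C * N c)" unfolding N_def by (intro sum_mono) (auto simp: N_def)
  also have "\<dots> = (\<epsilon> * C * card I) * N c" by simp
  also have "\<dots> \<le> 1 / 2 * N c" using \<epsilon> N0 by (intro mult_right_mono) auto
  finally have N': "N c' \<le> N c / 2" by simp
  have "P c' \<le> (\<Sum>j\<in>J. norm (c' j - c j) + norm (c j - c0 j))"
    unfolding P_def
  proof (intro sum_mono)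
    show "norm (c' j - c0 j) \<le> norm (c' j - c j) + norm (c j - c0 j)" for j
      using norm_triangle_ineq[of "c' j - c j" "c j - c0 j"] by simp
  qed
  also have "\<dots> \<le> C * N c + P c" using step by (simp add: sum.distrib P_def)
  finally have "P c' / (4 * C) \<le> N c / 4 + P c / (4 * C)" using C by (simp add: field_simps)
  moreover have "\<Phi> c \<le> \<Phi> c'" using min \<open>c' \<in> X\<close> by auto
  ultimately have "N c \<le> 0" using N' by (simp add: \<Phi>_def)
  then have "N c = 0" using N0[of c] by simp
  then show ?thesis using fin c by (auto simp: N_def sum_nonneg_eq_0_iff)
qed

section \<open>Deforming solutions\<close>

text \<open>A deformation of \<open>c ^ s\<close>, which is its value when all nodes
  \<open>z r\<close> are 0. Its weighted sums express conditions at separate nodes and remain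
  regular when nodes collide.\<close>

definition newton_kernel :: "(nat \<Rightarrow> complex) \<Rightarrow> nat \<Rightarrow> complex \<Rightarrow> complex"
  where "newton_kernel z s c = (\<Prod>r<s. c / (1 - z r * c))"

text \<open>The difference quotient of \<open>newton_kernel\<close> in its last argument, unfolded
  by the product rule so that no division by \<open>u - v\<close> occurs. It is continuous at
  \<open>u = v\<close>, where it gives the derivative.\<close>

fun kernel_quotient :: "(nat \<Rightarrow> complex) \<Rightarrow> nat \<Rightarrow> complex \<Rightarrow> complex \<Rightarrow> complex" where
  "kernel_quotient z 0 u v = 0"
| "kernel_quotient z (Suc s) u v =
    newton_kernel z s u / ((1 - z s * u) * (1 - z s * v)) + kernel_quotient z s u v * (v / (1 - z s * v))"

lemma newton_kernel_0: "newton_kernel (\<lambda>_. 0) s c = c ^ s"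
  by (simp add: newton_kernel_def)

lemma kernel_quotient_0: "kernel_quotient (\<lambda>_. 0) s c c = of_nat s * c ^ (s - 1)"
proof (induction s)
  case (Suc s)
  then show ?case by (cases s) (simp_all add: newton_kernel_0 algebra_simps)
qed simp

lemma newton_kernel_cong: "(\<And>r. r < s \<Longrightarrow> z r = z' r) \<Longrightarrow> newton_kernel z s c = newton_kernel z' s c"
  by (simp add: newton_kernel_def)

lemma kernel_quotient_cong:
  "(\<And>r. r < s \<Longrightarrow> z r = z' r) \<Longrightarrow> kernel_quotient z s u v = kernel_quotient z' s u v"
  by (induction s) (simp_all add: newton_kernel_cong[of _ z z'])

lemma newton_kernel_diff:
  assumes "\<And>r. r < s \<Longrightarrow> 1 - z r * u \<noteq> 0" "\<And>r. r < s \<Longrightarrow> 1 - z r * v \<noteq> 0"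
  shows "newton_kernel z s u - newton_kernel z s v = kernel_quotient z s u v * (u - v)"
  using assms
proof (induction s)
  case 0
  then show ?case by (simp add: newton_kernel_def)
next
  case (Suc s)
  have nz: "1 - z s * u \<noteq> 0" "1 - z s * v \<noteq> 0" using Suc.prems by auto
  have Suc': "newton_kernel z (Suc s) c = newton_kernel z s c * (c / (1 - z s * c))" for c
    by (simp add: newton_kernel_def)
  have "u / (1 - z s * u) - v / (1 - z s * v) = (u - v) / ((1 - z s * u) * (1 - z s * v))"
    using nz by (simp add: field_simps)
  moreover have "newton_kernel z (Suc s) u - newton_kernel z (Suc s) v =
    newton_kernel z s u * (u / (1 - z s * u) - v / (1 - z s * v)) +
    (newton_kernel z s u - newton_kernel z s v) * (v / (1 - z s * v))"
    unfolding Suc' by (simp add: algebra_simps)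
  moreover have "newton_kernel z s u - newton_kernel z s v = kernel_quotient z s u v * (u - v)"
    using Suc by simp
  ultimately show ?case by (simp only: kernel_quotient.simps) (simp add: distrib_right distrib_left mult.assoc mult.left_commute mult.commute)
qed

lemma dist_pair_le: "dist (x, y) (x', y') \<le> dist x x' + dist y y'"
  unfolding dist_Pair_Pair by (rule sqrt_sum_squares_le_sum) auto

lemma isCont_newton_kernel:
  fixes p :: "'a::t2_space"
  assumes "\<And>r. r < s \<Longrightarrow> isCont (\<lambda>x. z x r) p" "isCont f p"
    "\<And>r. r < s \<Longrightarrow> 1 - z p r * f p \<noteq> 0"
  shows "isCont (\<lambda>x. newton_kernel (z x) s (f x)) p"
  unfolding newton_kernel_def using assms by (intro continuous_prod isCont_divide continuous_intros) auto

lemma isCont_kernel_quotient: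
  fixes p :: "'a::t2_space"
  assumes "\<And>r. r < s \<Longrightarrow> isCont (\<lambda>x. z x r) p" "isCont f p" "isCont g p"
    "\<And>r. r < s \<Longrightarrow> 1 - z p r * f p \<noteq> 0" "\<And>r. r < s \<Longrightarrow> 1 - z p r * g p \<noteq> 0"
  shows "isCont (\<lambda>x. kernel_quotient (z x) s (f x) (g x)) p"
  using assms
proof (induction s)
  case (Suc s)
  have "isCont (\<lambda>x. kernel_quotient (z x) s (f x) (g x)) p" by (rule Suc.IH) (use Suc.prems in auto)
  moreover have "isCont (\<lambda>x. newton_kernel (z x) s (f x)) p"
    by (rule isCont_newton_kernel) (use Suc.prems in auto)
  moreover have "isCont (\<lambda>x. z x s) p" "1 - z p s * f p \<noteq> 0" "1 - z p s * g p \<noteq> 0" using Suc.prems by auto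
  ultimately show ?case unfolding kernel_quotient.simps
    using Suc.prems(2,3) by (intro isCont_add isCont_mult isCont_divide isCont_diff continuous_const) auto
qed simp

text \<open>At \<open>t0\<close> all nodes are 0, and the Jacobian at \<open>c0\<close> is a
  Vandermonde matrix with rows scaled by \<open>s + 1\<close> and columns by the weights. It has a
  right inverse, so Newton's method yields solutions nearby. Weights and nodes may both depend on
  \<open>t\<close>, which serves the two deformations below.\<close>

lemma newton_system_deform:
  fixes e :: "nat \<Rightarrow> real \<Rightarrow> complex" and z :: "real \<Rightarrow> nat \<Rightarrow> complex" and c0 :: "nat \<Rightarrow> complex"
  assumes inj: "inj_on c0 {..B}"
    and e: "\<And>j. j \<le> B \<Longrightarrow> e j t0 \<noteq> 0" "\<And>j. j \<le> B \<Longrightarrow> isCont (e j) t0"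
    and z: "\<And>r. r < B \<Longrightarrow> z t0 r = 0" "\<And>r. r < B \<Longrightarrow> isCont (\<lambda>t. z t r) t0"
    and sol: "\<And>s. s < B \<Longrightarrow> (\<Sum>j\<le>B. e j t0 * c0 j ^ Suc s) = 0"
    and "\<rho> > 0"
  shows "\<exists>\<delta>>0. \<forall>t. dist t t0 < \<delta> \<longrightarrow> (\<exists>c. (\<forall>j. dist (c0 j) (c j) \<le> \<rho>) \<and>
    (\<forall>j\<le>B. \<forall>r<B. 1 - z t r * c j \<noteq> 0) \<and>
    (\<forall>s<B. (\<Sum>j\<le>B. e j t * newton_kernel (z t) (Suc s) (c j)) = 0))"
proof -
  obtain L where L: "\<And>s s'. s \<le> B \<Longrightarrow> s' \<le> B \<Longrightarrow> (\<Sum>j\<le>B. c0 j ^ s * L j s') = (if s = s' then 1 else 0)"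
    using vandermonde_inverse[OF inj] by blast
  define D where "D s j = e j t0 * (of_nat (Suc s) * c0 j ^ s)" for s j
  \<comment> \<open>The rows and columns of the Vandermonde inverse are rescaled to undo the factors
    in \<open>D\<close>.\<close>
  define A where "A j s = L j s / (e j t0 * of_nat (Suc s))" for j s
  have DA: "(\<Sum>j\<le>B. D s j * A j s') = (if s = s' then 1 else 0)" if "s < B" "s' < B" for s s'
  proof -
    have "(\<Sum>j\<le>B. D s j * A j s') = (\<Sum>j\<le>B. of_nat (Suc s) / of_nat (Suc s') * (c0 j ^ s * L j s'))"
      using e(1) by (intro sum.cong refl) (auto simp: D_def A_def field_simps simp del: of_nat_Suc)
    also have "\<dots> = of_nat (Suc s) / of_nat (Suc s') * (if s = s' then 1 else 0)"
      using L[of s s'] that by (simp only: sum_distrib_left[symmetric])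
    finally show ?thesis by (simp del: of_nat_Suc)
  qed
  define C where "C = 1 + (\<Sum>s<B. \<Sum>j\<le>B. norm (A j s))"
  have C: "C > 0" by (auto simp: C_def sum_nonneg intro: add_pos_nonneg)
  have A: "(\<Sum>j\<le>B. norm (A j s)) \<le> C" if "s < B" for s
    using member_le_sum[of s "{..<B}" "\<lambda>s. \<Sum>j\<le>B. norm (A j s)"] that by (simp add: C_def sum_nonneg)
  \<comment> \<open>Small enough for the contraction factor 1/2; \<open>real B + 1\<close> keeps the
    denominator nonzero for \<open>B = 0\<close>.\<close>
  define \<epsilon> where "\<epsilon> = 1 / (2 * C * (real B + 1))"
  have "\<epsilon> * C * real B = real B / (2 * (real B + 1))" using C by (simp add: \<epsilon>_def)
  also have "\<dots> \<le> 1 / 2" by (simp add: field_simps)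
  finally have \<epsilon>: "\<epsilon> > 0" "\<epsilon> * C * real B \<le> 1 / 2" using C by (auto simp: \<epsilon>_def)
  define H where "H t s j u v = e j t * kernel_quotient (z t) (Suc s) u v" for t s j u v
  have H0: "H t0 s j (c0 j) (c0 j) = D s j" if "s < B" for s j
    using kernel_quotient_cong[of "Suc s" "z t0" "\<lambda>_. 0" "c0 j" "c0 j"] z(1) that
      kernel_quotient_0[of "Suc s" "c0 j"] by (simp add: H_def D_def del: kernel_quotient.simps)
  \<comment> \<open>What the Newton step needs near the start: no pole of the kernel, and secant
    slopes close to the Jacobian.\<close>
  define Q where "Q t j u v \<longleftrightarrow> (\<forall>r<B. 1 - z t r * u \<noteq> 0) \<and> (\<forall>s<B. dist (H t s j u v) (D s j) < \<epsilon>)" for t j u v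
  have "\<exists>\<eta>>0. \<forall>t u v. dist t t0 < \<eta> \<longrightarrow> dist (c0 j) u \<le> \<eta> \<longrightarrow> dist (c0 j) v \<le> \<eta> \<longrightarrow> Q t j u v"
    if j: "j \<le> B" for j
  proof -
    let ?p = "(t0, c0 j, c0 j)"
    have z': "isCont (\<lambda>p :: real \<times> complex \<times> complex. z (fst p) r) ?p" if "r < B" for r
      by (rule isCont_o2[where f=fst]) (use z(2) that in auto)
    have e': "isCont (\<lambda>p :: real \<times> complex \<times> complex. e j (fst p)) ?p"
      by (rule isCont_o2[where f=fst]) (use e(2) j in auto)
    have ev1: "\<forall>\<^sub>F p in nhds ?p. 1 - z (fst p) r * fst (snd p) \<noteq> 0" if "r < B" for r
    proof -
      have "isCont (\<lambda>p :: real \<times> complex \<times> complex. 1 - z (fst p) r * fst (snd p)) ?p"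
        by (intro continuous_intros z' that)
      moreover have "1 - z t0 r * c0 j \<noteq> 0" using z(1) that by simp
      ultimately show ?thesis
        using continuous_at_avoid[of ?p "\<lambda>p. 1 - z (fst p) r * fst (snd p)" 0]
        by (auto simp: eventually_nhds_metric dist_commute)
    qed
    have ev2: "\<forall>\<^sub>F p in nhds ?p. dist (H (fst p) s j (fst (snd p)) (snd (snd p))) (D s j) < \<epsilon>" if "s < B" for s
    proof -
      have "isCont (\<lambda>p. H (fst p) s j (fst (snd p)) (snd (snd p))) ?p"
        unfolding H_def using z(1) that
        by (intro isCont_mult isCont_kernel_quotient z' e' continuous_intros) auto
      then have "((\<lambda>p. H (fst p) s j (fst (snd p)) (snd (snd p))) \<longlongrightarrow> D s j) (nhds ?p)"
        using H0[OF that] by (simp add: isCont_def tendsto_nhds_iff)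
      then show ?thesis using \<epsilon>(1) by (rule tendstoD)
    qed
    have "\<forall>\<^sub>F p in nhds ?p. (\<forall>r\<in>{..<B}. 1 - z (fst p) r * fst (snd p) \<noteq> 0) \<and>
      (\<forall>s\<in>{..<B}. dist (H (fst p) s j (fst (snd p)) (snd (snd p))) (D s j) < \<epsilon>)"
      using ev1 ev2 by (intro eventually_conj eventually_ball_finite) auto
    then obtain d where d: "d > 0" "\<And>p. dist p ?p < d \<Longrightarrow> Q (fst p) j (fst (snd p)) (snd (snd p))"
      unfolding eventually_nhds_metric Q_def by auto
    \<comment> \<open>Three coordinates, each off by at most a quarter of \<open>d\<close>, stay
      within distance \<open>d\<close> in total.\<close>
    have "Q t j u v" if "dist t t0 < d / 4" "dist (c0 j) u \<le> d / 4" "dist (c0 j) v \<le> d / 4" for t u v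
    proof -
      have "dist (t, u, v) ?p \<le> dist t t0 + (dist u (c0 j) + dist v (c0 j))"
        using dist_pair_le[of t "(u, v)" t0 "(c0 j, c0 j)"] dist_pair_le[of u v "c0 j" "c0 j"] by simp
      also have "\<dots> < d" using that d(1) by (simp add: dist_commute)
      finally show ?thesis using d(2) by fastforce
    qed
    then show ?thesis using d(1) by (intro exI[of _ "d / 4"]) auto
  qed
  then obtain \<eta> where \<eta>: "\<And>j. j \<le> B \<Longrightarrow> \<eta> j > 0" and Q: "\<And>j t u v. j \<le> B \<Longrightarrow> dist t t0 < \<eta> j \<Longrightarrow>
      dist (c0 j) u \<le> \<eta> j \<Longrightarrow> dist (c0 j) v \<le> \<eta> j \<Longrightarrow> Q t j u v" by metis
  define \<eta>0 where "\<eta>0 = Min (insert \<rho> (\<eta> ` {..B}))"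
  have \<eta>0: "\<eta>0 > 0" "\<eta>0 \<le> \<rho>" "\<And>j. j \<le> B \<Longrightarrow> \<eta>0 \<le> \<eta> j"
    using \<eta> \<open>\<rho> > 0\<close> by (auto simp: \<eta>0_def intro!: min.coboundedI2 Min_le)
  define F where "F t s c = (\<Sum>j\<le>B. e j t * newton_kernel (z t) (Suc s) (c j))" for t s and c :: "nat \<Rightarrow> complex"
  have F0: "F t0 s c0 = 0" if "s < B" for s
    using sol[OF that] newton_kernel_cong[of "Suc s" "z t0" "\<lambda>_. 0"] z(1) that
    by (simp add: F_def newton_kernel_0)
  \<comment> \<open>The residual of the old solution \<open>c0\<close> tends to 0 as
    \<open>t\<close> tends to \<open>t0\<close>, so it eventually meets the starting condition of
    the Newton step.\<close>
  have "isCont (\<lambda>t. \<Sum>s<B. norm (F t s c0)) t0"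
    unfolding F_def using z e
    by (intro continuous_sum continuous_norm continuous_mult isCont_newton_kernel continuous_const) auto
  then have "((\<lambda>t. \<Sum>s<B. norm (F t s c0)) \<longlongrightarrow> 0) (nhds t0)"
    using F0 by (simp add: isCont_def tendsto_nhds_iff)
  moreover have "\<eta>0 / (5 * C) > 0" using \<eta>0 C by simp
  ultimately have "\<forall>\<^sub>F t in nhds t0. dist (\<Sum>s<B. norm (F t s c0)) 0 < \<eta>0 / (5 * C)"
    by (rule tendstoD)
  then obtain d where d: "d > 0" "\<And>t. dist t t0 < d \<Longrightarrow> (\<Sum>s<B. norm (F t s c0)) < \<eta>0 / (5 * C)"
    unfolding eventually_nhds_metric by (auto simp: sum_nonneg)
  have "\<exists>c. (\<forall>j. dist (c0 j) (c j) \<le> \<rho>) \<and> (\<forall>j\<le>B. \<forall>r<B. 1 - z t r * c j \<noteq> 0) \<and> (\<forall>s<B. F t s c = 0)"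
    if t: "dist t t0 < min d \<eta>0" for t
  proof -
    define X where "X = {c. \<forall>j. c j \<in> cball (c0 j) \<eta>0}"
    have QX: "Q t j (c j) (c' j)" if "j \<le> B" "c \<in> X" "c' \<in> X" for j c c'
      using t \<eta>0(3)[OF that(1)] that(2,3) by (intro Q that(1)) (auto simp: X_def intro: order.trans)
    have nz: "1 - z t r * c j \<noteq> 0" if "j \<le> B" "r < B" "c \<in> X" for j r c
      using QX[OF that(1,3,3)] that(2) by (auto simp: Q_def)
    have "\<exists>c\<in>X. \<forall>s\<in>{..<B}. F t s c = 0"
      unfolding X_def
    proof (rule approximate_newton_zero[where J="{..B}" and D=D and A=A and \<epsilon>=\<epsilon> and C=C
          and H="\<lambda>s j c c'. H t s j (c' j) (c j)"], unfold X_def[symmetric])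
      fix s assume s: "s \<in> {..<B}"
      have "continuous_on X (\<lambda>c. c j)" for j
        by (rule continuous_on_subset[OF continuous_on_product_coordinates]) auto
      then show "continuous_on X (F t s)"
        unfolding F_def newton_kernel_def using nz s
        by (intro continuous_on_sum continuous_on_mult continuous_on_prod continuous_on_divide
            continuous_on_diff continuous_on_const) auto
      show "F t s c' - F t s c = (\<Sum>j\<le>B. H t s j (c' j) (c j) * (c' j - c j))" if "c \<in> X" "c' \<in> X" for c c'
        unfolding F_def sum_subtractf[symmetric]
      proof (intro sum.cong refl)
        fix j assume "j \<in> {..B}"
        then have "newton_kernel (z t) (Suc s) (c' j) - newton_kernel (z t) (Suc s) (c j) =
          kernel_quotient (z t) (Suc s) (c' j) (c j) * (c' j - c j)"
          using nz s that by (intro newton_kernel_diff) auto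
        then show "e j t * newton_kernel (z t) (Suc s) (c' j) - e j t * newton_kernel (z t) (Suc s) (c j) =
          H t s j (c' j) (c j) * (c' j - c j)"
          unfolding H_def by (metis mult.assoc right_diff_distrib)
      qed
      show "norm (H t s j (c' j) (c j) - D s j) \<le> \<epsilon>" if "j \<in> {..B}" "c \<in> X" "c' \<in> X" for j c c'
        using QX[of j c' c] that s by (auto simp: Q_def dist_norm intro: less_imp_le)
    next
      have "(\<Sum>s<B. norm (F t s c0)) \<le> \<eta>0 / (5 * C)" using d(2) t by force
      then show "5 * C * (\<Sum>s<B. norm (F t s c0)) \<le> \<eta>0" using C by (simp add: field_simps)
    qed (use \<eta>0 C A DA \<epsilon> in auto)
    then obtain c where c: "c \<in> X" "\<forall>s<B. F t s c = 0" by auto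
    moreover have "dist (c0 j) (c j) \<le> \<rho>" for j using c(1) order.trans[OF _ \<eta>0(2)] by (auto simp: X_def)
    ultimately show ?thesis using nz by blast
  qed
  then show ?thesis unfolding F_def using d(1) \<eta>0(1) by (intro exI[of _ "min d \<eta>0"]) auto
qed

section \<open>The continuity method for the weights and the separation of the nodes\<close>

lemma power_sums_roots_of_unity:
  assumes "s < B"
  shows "(\<Sum>j\<le>B. cis (2 * pi * real j / real (Suc B)) ^ Suc s) = 0"
proof -
  \<comment> \<open>The power sum is a geometric sum in this root of unity, which differs from 1
    because \<open>s < B\<close> prevents \<open>B + 1\<close> from dividing
    \<open>s + 1\<close>.\<close>
  define \<omega> where "\<omega> = cis (2 * pi * real (Suc s) / real (Suc B))"
  have "cis (2 * pi * real j / real (Suc B)) ^ Suc s = \<omega> ^ j" for j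
  proof -
    have "real (Suc s) * (2 * pi * real j / real (Suc B)) = real j * (2 * pi * real (Suc s) / real (Suc B))"
      by simp
    then show ?thesis unfolding \<omega>_def Complex.DeMoivre by (rule arg_cong)
  qed
  then have "(\<Sum>j\<le>B. cis (2 * pi * real j / real (Suc B)) ^ Suc s) = (\<Sum>j<Suc B. \<omega> ^ j)"
    by (simp only: lessThan_Suc_atMost)
  also have "\<dots> = (\<omega> ^ Suc B - 1) / (\<omega> - 1)"
  proof (rule geometric_sum)
    show "\<omega> \<noteq> 1"
    proof
      assume "\<omega> = 1"
      then have "cos (2 * pi * real (Suc s) / real (Suc B)) = 1"
        unfolding \<omega>_def by (metis cis.sel(1) one_complex.sel(1))
      then obtain n :: int where "2 * pi * real (Suc s) / real (Suc B) = of_int n * 2 * pi"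
        by (auto simp: cos_one_2pi_int)
      then have "real (Suc s) = of_int n * real (Suc B)" by (simp add: field_simps del: of_nat_Suc)
      then have "int (Suc s) = n * int (Suc B)"
        by (metis of_int_eq_iff of_int_mult of_int_of_nat_eq)
      then have "int (Suc B) dvd int (Suc s)" by simp
      then have "Suc B dvd Suc s" by (simp only: int_dvd_int_iff)
      then show False using assms by (auto dest: dvd_imp_le)
    qed
  qed
  also have "\<omega> ^ Suc B = 1"
  proof -
    have "\<omega> ^ Suc B = cis (2 * pi * real (Suc s))"
      unfolding \<omega>_def Complex.DeMoivre by (simp del: of_nat_Suc power_Suc)
    also have "\<dots> = 1" by (rule cis_multiple_2pi) simp
    finally show ?thesis .
  qed
  finally show ?thesis by simp
qed

text \<open>The radius is a third of the least modulus and least mutual distance: two moved points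
  approach each other by at most two thirds of their distance.\<close>

lemma separation_radius:
  fixes c :: "nat \<Rightarrow> complex"
  assumes "inj_on c {..B}" "\<forall>j\<le>B. c j \<noteq> 0"
  obtains \<rho> where "\<rho> > 0" "\<And>c'. (\<And>j. j \<le> B \<Longrightarrow> dist (c j) (c' j) \<le> \<rho>) \<Longrightarrow> inj_on c' {..B} \<and> (\<forall>j\<le>B. c' j \<noteq> 0)"
proof -
  define X where "X = (\<lambda>j. norm (c j)) ` {..B} \<union> (\<lambda>(i, j). dist (c i) (c j)) ` {(i, j). i \<le> B \<and> j \<le> B \<and> i \<noteq> j}"
  have "finite {(i, j). i \<le> B \<and> j \<le> B \<and> i \<noteq> j}"
    by (rule finite_subset[of _ "{..B} \<times> {..B}"]) auto
  then have X: "finite X" "X \<noteq> {}" by (auto simp: X_def)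
  have "x > 0" if "x \<in> X" for x using that assms by (auto simp: X_def inj_on_def)
  then have pos: "Min X > 0" using X by simp
  show ?thesis
  proof (rule that[of "Min X / 3"])
    show "Min X / 3 > 0" using pos by simp
    fix c' assume close: "\<And>j. j \<le> B \<Longrightarrow> dist (c j) (c' j) \<le> Min X / 3"
    have "c' j \<noteq> 0" if "j \<le> B" for j
    proof
      assume "c' j = 0"
      then have "norm (c j) \<le> Min X / 3" using close[OF that] by simp
      moreover have "Min X \<le> norm (c j)" using X that by (auto simp: X_def)
      ultimately show False using pos by simp
    qed
    moreover have "c' i \<noteq> c' j" if "i \<le> B" "j \<le> B" "i \<noteq> j" for i j
    proof
      assume "c' i = c' j"
      then have "dist (c i) (c j) \<le> 2 * Min X / 3"
        using close[OF that(1)] close[OF that(2)] dist_triangle2[of "c i" "c j" "c' j"] by simp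
      moreover have "Min X \<le> dist (c i) (c j)" using X that by (intro Min_le) (auto simp: X_def)
      ultimately show False using pos by simp
    qed
    ultimately show "inj_on c' {..B} \<and> (\<forall>j\<le>B. c' j \<noteq> 0)" by (auto simp: inj_on_def)
  qed
qed

text \<open>Connectedness of the parameter interval carries solvability from equal weights to
  arbitrary positive ones.\<close>

lemma weighted_power_sums_zero:
  fixes w :: "nat \<Rightarrow> real"
  assumes w: "\<And>j. j \<le> B \<Longrightarrow> w j > 0"
  shows "\<exists>c. (\<exists>i\<le>B. c i \<noteq> 0) \<and> (\<forall>s<B. (\<Sum>j\<le>B. complex_of_real (w j) * c j ^ Suc s) = 0)"
proof -
  \<comment> \<open>From 1 at \<open>t = 0\<close> to \<open>w j\<close> at \<open>t = 1\<close>; as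
    a convex combination it stays positive, as the rigidity of solutions requires.\<close>
  define e where "e j t = 1 + t * (w j - 1)" for j t
  define sol where "sol t c \<longleftrightarrow> (\<forall>s<B. (\<Sum>j\<le>B. complex_of_real (e j t) * c j ^ Suc s) = 0)" for t c
  define T where "T = {t \<in> {0..1}. \<exists>c. (\<exists>i\<le>B. c i \<noteq> 0) \<and> sol t c}"
  have e_pos: "e j t > 0" if "j \<le> B" "t \<in> {0..1}" for j t
  proof (cases "t = 1")
    case False
    then have "0 < (1 - t) + t * w j"
      using w[OF that(1)] that(2) by (intro add_pos_nonneg) auto
    then show ?thesis by (simp add: e_def algebra_simps)
  qed (use w[OF that(1)] in \<open>simp add: e_def\<close>)
  have "openin (top_of_set {0..1}) T"
    unfolding openin_euclidean_subtopology_iff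
  proof (intro conjI ballI)
    show "T \<subseteq> {0..1}" by (auto simp: T_def)
    fix t0 assume "t0 \<in> T"
    then obtain c i where t0: "t0 \<in> {0..1}" and c: "i \<le> B" "c i \<noteq> 0" "sol t0 c" by (auto simp: T_def)
    \<comment> \<open>Any nonzero solution is automatically nondegenerate, so it can be deformed;
      here the nodes stay at 0 and only the weights move.\<close>
    then have c': "inj_on c {..B} \<and> (\<forall>j\<le>B. c j \<noteq> 0)"
      using e_pos by (intro power_sums_zero_imp_inj[where w="\<lambda>j. e j t0"]) (auto simp: sol_def)
    then obtain \<rho> where \<rho>: "\<rho> > 0" "\<And>c'. (\<And>j. j \<le> B \<Longrightarrow> dist (c j) (c' j) \<le> \<rho>) \<Longrightarrow>
        inj_on c' {..B} \<and> (\<forall>j\<le>B. c' j \<noteq> 0)" using separation_radius[of c B] by blast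
    have "\<exists>\<delta>>0. \<forall>t. dist t t0 < \<delta> \<longrightarrow> (\<exists>c'. (\<forall>j. dist (c j) (c' j) \<le> \<rho>) \<and>
        (\<forall>j\<le>B. \<forall>r<B. 1 - (\<lambda>_. 0) r * c' j \<noteq> 0) \<and>
        (\<forall>s<B. (\<Sum>j\<le>B. complex_of_real (e j t) * newton_kernel (\<lambda>_. 0) (Suc s) (c' j)) = 0))"
    proof (rule newton_system_deform)
      show "isCont (\<lambda>t. complex_of_real (e j t)) t0" for j
        unfolding e_def by (intro continuous_intros)
    qed (use c' c(3) e_pos t0 \<rho>(1) in \<open>auto simp: sol_def less_imp_neq[symmetric]\<close>)
    then obtain \<delta> where \<delta>: "\<delta> > 0" "\<And>t. dist t t0 < \<delta> \<Longrightarrow> \<exists>c'. (\<forall>j. dist (c j) (c' j) \<le> \<rho>) \<and> sol t c'"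
      by (auto simp: sol_def newton_kernel_0)
    have "t \<in> T" if t: "t \<in> {0..1}" "dist t t0 < \<delta>" for t
    proof -
      obtain c' where c': "\<And>j. dist (c j) (c' j) \<le> \<rho>" "sol t c'" using \<delta>(2)[OF t(2)] by blast
      then show ?thesis using \<rho>(2)[of c'] t(1) by (auto simp: T_def)
    qed
    then show "\<exists>d>0. \<forall>t\<in>{0..1}. dist t t0 < d \<longrightarrow> t \<in> T" using \<delta>(1) by auto
  qed
  moreover have "closed T"
  proof -
    define X :: "(nat \<Rightarrow> complex) set" where "X = {c. \<forall>j. c j \<in> cball 0 1}"
    have X: "compact X" using compact_box[of "\<lambda>_. 0" "\<lambda>_. 1"] by (simp add: X_def)
    \<comment> \<open>Each equation is homogeneous, so nonzero solutions can be scaled to total norm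
      1. This keeps limits nonzero and makes \<open>T\<close> the projection of a compact
      set.\<close>
    define Y where "Y = {p \<in> {0..1} \<times> X. (\<Sum>j\<le>B. norm (snd p j)) = 1 \<and> sol (fst p) (snd p)}"
    have coord: "continuous_on UNIV (\<lambda>p :: real \<times> (nat \<Rightarrow> complex). snd p j)" for j
      by (rule continuous_on_product_then_coordinatewise[OF continuous_on_snd[OF continuous_on_id]])
    have "closed {p :: real \<times> (nat \<Rightarrow> complex). (\<Sum>j\<le>B. norm (snd p j)) = 1}"
      by (intro closed_Collect_eq continuous_on_sum continuous_on_norm continuous_on_const coord)
    moreover have "closed {p. sol (fst p) (snd p)}"
      unfolding sol_def e_def
      by (intro closed_Collect_all closed_Collect_imp open_Collect_const closed_Collect_eq
          continuous_on_sum continuous_on_mult continuous_on_power coord continuous_on_const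
          continuous_on_of_real continuous_on_add continuous_on_fst continuous_on_id)
    moreover have "Y = ({0..1} \<times> X) \<inter> ({p. (\<Sum>j\<le>B. norm (snd p j)) = 1} \<inter> {p. sol (fst p) (snd p)})"
      by (auto simp: Y_def)
    ultimately have "compact Y"
      using X by (auto intro!: compact_Int_closed compact_Times closed_Int)
    then have "compact (fst ` Y)" by (intro compact_continuous_image continuous_on_fst continuous_on_id)
    moreover have "fst ` Y = T"
    proof
      show "fst ` Y \<subseteq> T"
      proof
        fix t assume "t \<in> fst ` Y"
        then obtain c where c: "t \<in> {0..1}" "(\<Sum>j\<le>B. norm (c j)) = 1" "sol t c" by (auto simp: Y_def)
        have "\<exists>i\<le>B. c i \<noteq> 0"
        proof (rule ccontr)
          assume "\<not> ?thesis"
          then have "(\<Sum>j\<le>B. norm (c j)) = 0" by (intro sum.neutral) auto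
          then show False using c(2) by simp
        qed
        then show "t \<in> T" using c by (auto simp: T_def)
      qed
      show "T \<subseteq> fst ` Y"
      proof
        fix t assume "t \<in> T"
        then obtain c i where c: "t \<in> {0..1}" "i \<le> B" "c i \<noteq> 0" "sol t c" by (auto simp: T_def)
        define N where "N = (\<Sum>j\<le>B. norm (c j))"
        have le: "norm (c j) \<le> N" if "j \<le> B" for j
          unfolding N_def using that by (intro member_le_sum) auto
        have N: "N > 0" using le[OF c(2)] c(3) by (smt (verit) zero_less_norm_iff)
        \<comment> \<open>Coordinates beyond \<open>B\<close> do not enter the system; setting them
          to 0 places the point in the compact box.\<close>
        define c' where "c' j = (if j \<le> B then c j / of_real N else 0)" for j
        have "(\<Sum>j\<le>B. norm (c' j)) = (\<Sum>j\<le>B. norm (c j) / N)"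
          using N by (intro sum.cong) (auto simp: c'_def norm_divide)
        also have "\<dots> = 1" using N by (simp add: sum_divide_distrib[symmetric] N_def)
        finally have "(\<Sum>j\<le>B. norm (c' j)) = 1" .
        moreover have "c' \<in> X" using N le by (auto simp: X_def c'_def norm_divide)
        moreover have "sol t c'"
          unfolding sol_def
        proof (intro allI impI)
          fix s assume "s < B"
          have "(\<Sum>j\<le>B. complex_of_real (e j t) * c' j ^ Suc s) =
            (\<Sum>j\<le>B. complex_of_real (e j t) * c j ^ Suc s / of_real N ^ Suc s)"
            by (intro sum.cong) (auto simp: c'_def power_divide)
          also have "\<dots> = 0"
            using c(4) \<open>s < B\<close> unfolding sol_def by (simp only: sum_divide_distrib[symmetric]) simp
          finally show "(\<Sum>j\<le>B. complex_of_real (e j t) * c' j ^ Suc s) = 0" .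
        qed
        ultimately have "(t, c') \<in> Y" using c(1) by (auto simp: Y_def)
        then show "t \<in> fst ` Y" by force
      qed
    qed
    ultimately show ?thesis by (simp add: compact_imp_closed)
  qed
  moreover have "0 \<in> T"
    unfolding T_def sol_def e_def using power_sums_roots_of_unity[of _ B]
    by (auto intro!: exI[of _ "\<lambda>j. cis (2 * pi * real j / real (Suc B))"] simp del: power_Suc of_nat_Suc)
  moreover have "T \<subseteq> {0..1}" by (auto simp: T_def)
  moreover have "connected {0..1::real}" by simp
  ultimately have "T = {0..1}"
    unfolding connected_clopen by (metis closed_subset empty_iff)
  then have "1 \<in> T" by simp
  then show ?thesis by (simp add: T_def sol_def e_def)
qed

text \<open>The weights are now fixed and \<open>t\<close> scales the nodes, which all collapse to 0
  at \<open>t = 0\<close>. Repeated values \<open>z r\<close> are allowed and will yield multiple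
  critical points.\<close>

lemma newton_system_solvable:
  fixes w :: "nat \<Rightarrow> real" and z :: "nat \<Rightarrow> complex"
  assumes w: "\<And>j. j \<le> B \<Longrightarrow> w j > 0"
  shows "\<exists>\<delta>>0. \<forall>t::real. \<bar>t\<bar> < \<delta> \<longrightarrow> (\<exists>c. inj_on c {..B} \<and> (\<forall>j\<le>B. c j \<noteq> 0) \<and>
    (\<forall>j\<le>B. \<forall>r<B. 1 - of_real t * z r * c j \<noteq> 0) \<and>
    (\<forall>s<B. (\<Sum>j\<le>B. complex_of_real (w j) * newton_kernel (\<lambda>r. of_real t * z r) (Suc s) (c j)) = 0))"
proof -
  obtain c i where c: "i \<le> B" "c i \<noteq> 0" "\<And>s. s < B \<Longrightarrow> (\<Sum>j\<le>B. complex_of_real (w j) * c j ^ Suc s) = 0"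
    using weighted_power_sums_zero[of B w] w by blast
  then have c': "inj_on c {..B} \<and> (\<forall>j\<le>B. c j \<noteq> 0)"
    using w by (intro power_sums_zero_imp_inj[where w=w]) auto
  then obtain \<rho> where \<rho>: "\<rho> > 0" "\<And>c'. (\<And>j. j \<le> B \<Longrightarrow> dist (c j) (c' j) \<le> \<rho>) \<Longrightarrow>
      inj_on c' {..B} \<and> (\<forall>j\<le>B. c' j \<noteq> 0)" using separation_radius[of c B] by blast
  have "\<exists>\<delta>>0. \<forall>t. dist t 0 < \<delta> \<longrightarrow> (\<exists>c'. (\<forall>j. dist (c j) (c' j) \<le> \<rho>) \<and>
      (\<forall>j\<le>B. \<forall>r<B. 1 - (of_real t * z r) * c' j \<noteq> 0) \<and>
      (\<forall>s<B. (\<Sum>j\<le>B. complex_of_real (w j) * newton_kernel (\<lambda>r. of_real t * z r) (Suc s) (c' j)) = 0))"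
  proof (rule newton_system_deform)
    show "isCont (\<lambda>t. complex_of_real t * z r) 0" for r by (intro continuous_intros)
  qed (use c' c(3) w \<rho>(1) in \<open>auto simp: less_imp_neq[symmetric]\<close>)
  then obtain \<delta> where \<delta>: "\<delta> > 0" "\<And>t. dist t 0 < \<delta> \<Longrightarrow> \<exists>c'. (\<forall>j. dist (c j) (c' j) \<le> \<rho>) \<and>
      (\<forall>j\<le>B. \<forall>r<B. 1 - (of_real t * z r) * c' j \<noteq> 0) \<and>
      (\<forall>s<B. (\<Sum>j\<le>B. complex_of_real (w j) * newton_kernel (\<lambda>r. of_real t * z r) (Suc s) (c' j)) = 0)"
    by blast
  show ?thesis
  proof (intro exI[of _ \<delta>] conjI allI impI)
    fix t :: real assume "\<bar>t\<bar> < \<delta>"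
    then obtain c' where "\<And>j. dist (c j) (c' j) \<le> \<rho>" "\<forall>j\<le>B. \<forall>r<B. 1 - (of_real t * z r) * c' j \<noteq> 0"
      "\<forall>s<B. (\<Sum>j\<le>B. complex_of_real (w j) * newton_kernel (\<lambda>r. of_real t * z r) (Suc s) (c' j)) = 0"
      using \<delta>(2)[of t] by auto
    with \<rho>(2)[of c'] show "\<exists>c. inj_on c {..B} \<and> (\<forall>j\<le>B. c j \<noteq> 0) \<and>
      (\<forall>j\<le>B. \<forall>r<B. 1 - of_real t * z r * c j \<noteq> 0) \<and>
      (\<forall>s<B. (\<Sum>j\<le>B. complex_of_real (w j) * newton_kernel (\<lambda>r. of_real t * z r) (Suc s) (c j)) = 0)"
      by blast
  qed (rule \<delta>(1))
qed

text \<open>For \<open>c = 1 / a\<close> the value \<open>newton_kernel z (Suc s) c\<close> is, up to sign, the divided difference of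
  \<open>x \<mapsto> 1 / (x - a)\<close> at \<open>z 0, \<dots>, z s\<close>, so the system says that \<open>\<Sum>j\<le>B. w j / (x - a j)\<close> vanishes at
  the \<open>z r\<close>, with multiplicities.\<close>

lemma newton_system_imp_critical_points:
  fixes c :: "nat \<Rightarrow> complex" and w :: "nat \<Rightarrow> complex"
  assumes nz: "\<And>j. j \<le> B \<Longrightarrow> c j \<noteq> 0" "\<And>j r. j \<le> B \<Longrightarrow> r < B \<Longrightarrow> 1 - z r * c j \<noteq> 0"
    and sol: "\<And>s. s < B \<Longrightarrow> (\<Sum>j\<le>B. w j * newton_kernel z (Suc s) (c j)) = 0"
    and w: "(\<Sum>j\<le>B. w j) \<noteq> 0"
  shows "(\<Sum>j\<le>B. smult (w j) (\<Prod>i\<in>{..B} - {j}. [:- inverse (c i), 1:])) =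
    smult (\<Sum>j\<le>B. w j) (\<Prod>r<B. [:- z r, 1:])"
proof -
  define a where "a j = inverse (c j)" for j
  define l where "l j = (\<Prod>i\<in>{..B} - {j}. [:- a i, 1:])" for j
  define full where "full = (\<Prod>i\<le>B. [:- a i, 1:])"
  have full: "[:- a j, 1:] * l j = full" if "j \<le> B" for j
    unfolding full_def l_def using prod.remove[of "{..B}" j "\<lambda>i. [:- a i, 1:]"] that by simp
  \<comment> \<open>\<open>P 0\<close> is the numerator of the sum of
    \<open>w j / (x - a j)\<close>. Each equation of the system removes a multiple of
    \<open>full\<close> and exposes one more factor \<open>x - z s\<close>.\<close>
  define P where "P s = (\<Sum>j\<le>B. smult (w j * newton_kernel z s (c j)) (l j))" for s
  have "P 0 = (\<Prod>r<s. [:- z r, 1:]) * P s" if "s \<le> B" for s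
    using that
  proof (induction s)
    case (Suc s)
    have "P s = (\<Sum>j\<le>B. [:- z s, 1:] * smult (w j * newton_kernel z (Suc s) (c j)) (l j) -
      smult (w j * newton_kernel z (Suc s) (c j)) full)"
      unfolding P_def
    proof (intro sum.cong refl)
      fix j assume j: "j \<in> {..B}"
      define g where "g = newton_kernel z (Suc s) (c j)"
      have nz': "c j \<noteq> 0" "1 - z s * c j \<noteq> 0" using nz j Suc.prems by auto
      have "g = newton_kernel z s (c j) * (c j / (1 - z s * c j))"
        by (simp add: g_def newton_kernel_def)
      then have g: "newton_kernel z s (c j) = (a j - z s) * g"
        using nz' by (simp add: a_def field_simps)
      have "[:- z s, 1:] * smult (w j * g) (l j) - smult (w j * g) full =
        smult (w j * g) (([:- z s, 1:] - [:- a j, 1:]) * l j)"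
        using full[of j] j by (simp only: atMost_iff left_diff_distrib smult_diff_right mult_smult_right)
      also have "\<dots> = smult (w j * newton_kernel z s (c j)) (l j)"
        unfolding g by (simp add: mult_ac)
      finally show "smult (w j * newton_kernel z s (c j)) (l j) =
        [:- z s, 1:] * smult (w j * newton_kernel z (Suc s) (c j)) (l j) -
        smult (w j * newton_kernel z (Suc s) (c j)) full" by (simp add: g_def)
    qed
    also have "\<dots> = [:- z s, 1:] * P (Suc s) - smult (\<Sum>j\<le>B. w j * newton_kernel z (Suc s) (c j)) full"
      by (simp add: P_def sum_subtractf sum_distrib_left smult_sum)
    also have "\<dots> = [:- z s, 1:] * P (Suc s)" using sol[of s] Suc.prems by simp
    finally have "P s = [:- z s, 1:] * P (Suc s)" .
    moreover have "P 0 = (\<Prod>r<s. [:- z r, 1:]) * P s" using Suc by simp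
    ultimately show ?case by (simp only: prod.lessThan_Suc mult.assoc)
  qed simp
  from this[of B] have eq: "P 0 = (\<Prod>r<B. [:- z r, 1:]) * P B" by simp
  define Z where "Z = (\<Prod>r<B. [:- z r, 1:])"
  have Z: "degree Z = B" "lead_coeff Z = 1" "Z \<noteq> 0"
    unfolding Z_def by (simp add: degree_prod_sum_eq, simp only: lead_coeff_prod, simp, simp)
  have dl: "degree (l j) = B" "lead_coeff (l j) = 1" if "j \<le> B" for j
    unfolding l_def using that by (simp add: degree_prod_sum_eq, simp only: lead_coeff_prod, simp)
  have P0: "P 0 = (\<Sum>j\<le>B. smult (w j) (l j))" by (simp add: P_def newton_kernel_def)
  \<comment> \<open>Each \<open>l j\<close> is monic of degree \<open>B\<close>, so the coefficient
    here is the sum of the weights. As it is nonzero, \<open>P 0\<close> has the same degree as the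
    product over the nodes, and the cofactor \<open>P B\<close> is that constant.\<close>
  have "coeff (P 0) B = (\<Sum>j\<le>B. w j)" using dl by (simp add: P0 coeff_sum) 
  moreover have "degree (P 0) \<le> B"
    unfolding P0 using dl by (intro degree_sum_le) (auto intro: order.trans[OF degree_smult_le])
  ultimately have lead: "degree (P 0) = B" "lead_coeff (P 0) = (\<Sum>j\<le>B. w j)"
    using w by (metis le_antisym le_degree)+
  have "P B \<noteq> 0" using eq lead(2) w by auto
  then have "degree (P B) = 0" using lead(1) eq Z unfolding Z_def[symmetric] by (simp add: degree_mult_eq)
  then obtain q where q: "P B = [:q:]" by (auto elim: degree_eq_zeroE)
  have "q = (\<Sum>j\<le>B. w j)" using lead(2) Z \<open>P B \<noteq> 0\<close> unfolding eq Z_def[symmetric] q by (simp add: lead_coeff_mult)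
  then show ?thesis using eq q unfolding P0 l_def a_def by (simp add: mult.commute)
qed

section \<open>Integrals with prescribed zeros\<close>

lemma polys_over_mono: "K \<subseteq> L \<Longrightarrow> polys_over K \<subseteq> polys_over L"
  by (auto simp: polys_over_def)

text \<open>The constant of integration allows one zero to be prescribed, which settles the cases
  with at most one multiple root.\<close>

lemma antiderivative_over:
  assumes K: "complex_subfield K" and f: "f \<in> polys_over K" and a: "a \<in> K"
  obtains F where "F \<in> polys_over K" "pderiv F = f" "poly F a = 0"
proof -
  have sub: "subring_on K" using K by (rule complex_subfield_imp_subring_on)
  define G where "G = (\<Sum>i\<le>degree f. monom (coeff f i * inverse (of_nat (Suc i))) (Suc i))"
  have "coeff f i * inverse (of_nat (Suc i)) \<in> K" for i
    using f K subring_on_of_nat[OF sub, of "Suc i"]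
    by (auto simp: polys_over_def complex_subfield_def simp del: of_nat_Suc)
  then have G: "G \<in> polys_over K"
    unfolding G_def by (auto simp: polys_over_def coeff_sum intro!: subring_on_sum[OF sub] subring_onD(1)[OF sub])
  have "pderiv G = (\<Sum>i\<le>degree f. pderiv (monom (coeff f i * inverse (of_nat (Suc i))) (Suc i)))"
    unfolding G_def using higher_pderiv_sum[of 1 _ "{..degree f}"] by simp
  also have "\<dots> = (\<Sum>i\<le>degree f. monom (coeff f i) i)"
    by (intro sum.cong refl) (simp add: pderiv_monom del: of_nat_Suc)
  also have "\<dots> = f" by (rule poly_as_sum_of_monoms)
  finally have dG: "pderiv G = f" .
  show ?thesis
  proof (rule that[of "G - [:poly G a:]"])
    show "G - [:poly G a:] \<in> polys_over K"
      using G poly_in_subring[OF sub G a] by (intro polys_over_subring_intros[OF sub])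
  qed (use dG in \<open>simp_all add: pderiv_diff\<close>)
qed

text \<open>Integration raises the order at each \<open>a j\<close> by one because \<open>F\<close>
  vanishes there. The sum of all \<open>\<alpha> j + 1\<close> is thus at most
  \<open>degree F\<close>, hence at most the degree of the integrand plus one.\<close>

lemma integral_root_bound:
  assumes inj: "inj_on a {1..m}" and \<alpha>: "\<forall>j\<in>{1..m}. 2 \<le> \<alpha> j"
    and F: "pderiv F = root_product m \<alpha> a * root_product k \<beta> b" "\<forall>t\<in>a ` {1..m}. poly F t = 0"
  shows "m \<le> (\<Sum>i=1..k. \<beta> i) + 1"
proof -
  define f where "f = root_product m \<alpha> a * root_product k \<beta> b"
  have deg: "degree (root_product l \<gamma> c) = (\<Sum>i=1..l. \<gamma> i)" "root_product l \<gamma> c \<noteq> 0" for l \<gamma> c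
    by (simp_all add: root_product_def degree_prod_sum_eq degree_linear_power)
  have df: "degree f = (\<Sum>j=1..m. \<alpha> j) + (\<Sum>i=1..k. \<beta> i)" "f \<noteq> 0"
    using deg by (simp_all add: f_def degree_mult_eq)
  have "F \<noteq> 0" "pderiv F = f" using F df(2) by (auto simp: f_def)
  have ord: "Suc (\<alpha> j) \<le> order (a j) F" if j: "j \<in> {1..m}" for j
  proof -
    have "order (a j) F \<noteq> 0" using F(2) j \<open>F \<noteq> 0\<close> by (auto simp: order_root)
    then have "order (a j) F = Suc (order (a j) f)"
      using order_pderiv[of F "a j"] \<open>pderiv F = f\<close> \<open>F \<noteq> 0\<close> F(2) j by auto
    moreover have "[:- a j, 1:] ^ \<alpha> j dvd root_product m \<alpha> a"
      unfolding root_product_def using j by (intro dvd_prodI) auto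
    then have "[:- a j, 1:] ^ \<alpha> j dvd f" by (simp add: f_def)
    ultimately show ?thesis using df(2) by (simp add: order_divides)
  qed
  have "(\<Sum>j=1..m. Suc (\<alpha> j)) \<le> (\<Sum>j=1..m. order (a j) F)" using ord by (rule sum_mono)
  also have "\<dots> = (\<Sum>t\<in>a ` {1..m}. count (proots F) t)"
    using \<open>F \<noteq> 0\<close> by (subst sum.reindex[OF inj]) simp
  also have "\<dots> \<le> (\<Sum>t\<in>set_mset (proots F). count (proots F) t)"
    using F(2) \<open>F \<noteq> 0\<close> poly_roots_finite[OF \<open>F \<noteq> 0\<close>] by (intro sum_mono2) auto
  also have "\<dots> = degree F" by (simp add: size_proots_complex flip: size_multiset_overloaded_eq)
  also have "degree F \<le> Suc (degree f)" using degree_pderiv[of F] \<open>pderiv F = f\<close> by simp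
  finally show ?thesis using df(1) by (simp add: sum_Suc)
qed

text \<open>All roots of the integrand are positive integers, so it has no zero between 1 and 2,
  against the mean value theorem. In the application both points are among the
  \<open>a j\<close>.\<close>

lemma no_common_value_on_integers:
  assumes m: "2 \<le> m"
    and F: "pderiv F = root_product m \<alpha> of_nat * root_product k \<beta> (\<lambda>i. of_nat (m + i))"
  shows "poly F 1 \<noteq> poly F 2"
proof
  assume eq: "poly F 1 = poly F 2"
  define g where "g t = (\<Prod>j=1..m. (t - real j) ^ \<alpha> j) * (\<Prod>i=1..k. (t - real (m + i)) ^ \<beta> i)" for t
  have g: "poly (pderiv F) (of_real t) = complex_of_real (g t)" for t
    by (simp add: F root_product_def poly_prod g_def add_uminus_conv_diff[symmetric] add.commute
        del: add_uminus_conv_diff of_nat_add)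
  \<comment> \<open>\<open>F\<close> may have a non-real constant term; its real part is a real
    primitive of \<open>g\<close>.\<close>
  have deriv: "((\<lambda>t. Re (poly F (of_real t))) has_real_derivative g t) (at t)" for t
  proof -
    have "((\<lambda>t. poly F (of_real t)) has_vector_derivative poly (pderiv F) (of_real t)) (at t)"
      by (intro has_vector_derivative_real_field poly_DERIV)
    from bounded_linear.has_vector_derivative[OF bounded_linear_Re this]
    show ?thesis by (simp add: g has_real_derivative_iff_has_vector_derivative)
  qed
  obtain t where t: "1 < t" "t < 2" "Re (poly F (of_real 2)) - Re (poly F (of_real 1)) = (2 - 1) * g t"
    using MVT2[of 1 2 "\<lambda>t. Re (poly F (of_real t))" g] deriv by auto
  then have "g t = 0" using eq by simp
  moreover have "t \<noteq> real j" for j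
  proof
    assume "t = real j"
    then have "1 < j" "j < 2" using t by simp_all
    then show False by simp
  qed
  ultimately show False by (auto simp: g_def simp del: of_nat_add)
qed

lemma distinct_points_of_nat:
  assumes "subring_on K"
  shows "distinct_points K m of_nat k (\<lambda>i. of_nat (m + i))"
proof -
  have "complex_of_nat j \<noteq> of_nat (m + i)" if "j \<in> {1..m}" "i \<in> {1..k}" for i j
    using that by (simp only: of_nat_eq_iff) simp
  then show ?thesis using subring_on_of_nat[OF assms]
    by (auto simp: distinct_points_def inj_on_def simp del: of_nat_add)
qed

section \<open>Descent of the roots and construction of the integral over the algebraic
  numbers\<close>

lemma critical_points_descend:
  fixes a :: "nat \<Rightarrow> complex"
  assumes L: "alg_closed_subfield L" and inj: "inj_on a {..B}"
    and w: "\<And>j. w j \<in> L" and z: "\<And>r. r < n \<Longrightarrow> z r \<in> L" and v: "v \<in> L"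
    and eq: "(\<Sum>j\<le>B. smult (w j) (\<Prod>i\<in>{..B} - {j}. [:- a i, 1:])) = smult v (\<Prod>r<n. [:- z r, 1:])"
  obtains a' where "inj_on a' {..B}" "a' ` {..B} \<subseteq> L"
    "(\<Sum>j\<le>B. smult (w j) (\<Prod>i\<in>{..B} - {j}. [:- a' i, 1:])) = smult v (\<Prod>r<n. [:- z r, 1:])"
proof -
  have subL: "subring_on L" using L by (auto simp: alg_closed_subfield_def intro: complex_subfield_imp_subring_on)
  have "\<exists>R. specializable L R \<and> a ` {..B} \<subseteq> R" by (intro specializable_contains[OF L]) simp
  then obtain R where R: "specializable L R" "a ` {..B} \<subseteq> R" by blast
  then have subR: "subring_on R" and LR: "L \<subseteq> R" by (auto simp: specializable_def)
  \<comment> \<open>The product of all differences of the roots: a specialization that does not kill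
    it keeps the roots distinct.\<close>
  define d where "d = (\<Prod>i\<le>B. \<Prod>j\<in>{..B} - {i}. a i - a j)"
  have "d \<noteq> 0" using inj by (auto simp: d_def inj_on_def)
  have in_R: "a i - a j \<in> R" if "i \<le> B" "j \<le> B" for i j using R(2) that by (intro subring_on_diff[OF subR]) auto
  then have "d \<in> R" unfolding d_def by (intro subring_on_prod[OF subR]) auto
  then obtain f where f: "partial_hom R f" "f ` R \<subseteq> L" "\<And>x. x \<in> L \<Longrightarrow> f x = x" "f d \<noteq> 0"
    using R(1) \<open>d \<noteq> 0\<close> unfolding specializable_def by blast
  have fmult: "f (x * y) = f x * f y" if "x \<in> R" "y \<in> R" for x y using f(1) that by (auto simp: partial_hom_def)
  define a' where "a' i = f (a i)" for i
  have "f d = (\<Prod>i\<le>B. f (\<Prod>j\<in>{..B} - {i}. a i - a j))"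
    unfolding d_def using in_R by (intro partial_hom_prod[OF subR f(1)] subring_on_prod[OF subR]) auto
  also have "\<dots> = (\<Prod>i\<le>B. \<Prod>j\<in>{..B} - {i}. f (a i - a j))"
    using in_R by (intro prod.cong refl partial_hom_prod[OF subR f(1)]) auto
  also have "\<dots> = (\<Prod>i\<le>B. \<Prod>j\<in>{..B} - {i}. a' i - a' j)"
    unfolding a'_def using R(2) by (intro prod.cong refl partial_hom_diff[OF subR f(1)]) auto
  finally have "f d = (\<Prod>i\<le>B. \<Prod>j\<in>{..B} - {i}. a' i - a' j)" .
  then have "inj_on a' {..B}" using f(4) by (auto simp: inj_on_def)
  moreover have "a' ` {..B} \<subseteq> L" using f(2) R(2) by (auto simp: a'_def)
  moreover have "(\<Sum>j\<le>B. smult (w j) (\<Prod>i\<in>{..B} - {j}. [:- a' i, 1:])) = smult v (\<Prod>r<n. [:- z r, 1:])" (is "?p = ?q")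
  proof -
    \<comment> \<open>The identity is transported value by value at points of \<open>L\<close>,
      which \<open>f\<close> fixes together with the weights, the nodes and \<open>v\<close>; as
      \<open>L\<close> is infinite, this determines the polynomials.\<close>
    have "poly ?p x = poly ?q x" if x: "x \<in> L" for x
    proof -
      have xa: "x - a i \<in> R" "f (x - a i) = x - a' i" if "i \<le> B" for i
        using R(2) x LR that f(3)[OF x] by (auto simp: a'_def partial_hom_diff[OF subR f(1)] subring_on_diff[OF subR] subset_iff image_subset_iff)
      have prod_in: "(\<Prod>i\<in>{..B} - {j}. x - a i) \<in> R" for j using xa by (intro subring_on_prod[OF subR]) auto
      have wR: "w j \<in> R" for j using w LR by auto
      have "poly ?p x = (\<Sum>j\<le>B. w j * (\<Prod>i\<in>{..B} - {j}. x - a' i))"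
        by (simp add: poly_sum poly_prod)
      also have "\<dots> = (\<Sum>j\<le>B. f (w j * (\<Prod>i\<in>{..B} - {j}. x - a i)))"
      proof (intro sum.cong refl)
        fix j
        have "f (\<Prod>i\<in>{..B} - {j}. x - a i) = (\<Prod>i\<in>{..B} - {j}. f (x - a i))"
          using xa by (intro partial_hom_prod[OF subR f(1)]) auto
        also have "\<dots> = (\<Prod>i\<in>{..B} - {j}. x - a' i)" using xa by (intro prod.cong refl) auto
        finally show "w j * (\<Prod>i\<in>{..B} - {j}. x - a' i) = f (w j * (\<Prod>i\<in>{..B} - {j}. x - a i))"
          using prod_in wR by (simp add: fmult f(3)[OF w])
      qed
      also have "\<dots> = f (\<Sum>j\<le>B. w j * (\<Prod>i\<in>{..B} - {j}. x - a i))"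
        using prod_in wR by (intro partial_hom_sum[OF subR f(1), symmetric] subring_onD(4)[OF subR])
      also have "(\<Sum>j\<le>B. w j * (\<Prod>i\<in>{..B} - {j}. x - a i)) = v * (\<Prod>r<n. x - z r)"
        using arg_cong[OF eq, of "\<lambda>p. poly p x"] by (simp add: poly_sum poly_prod)
      also have "f \<dots> = v * (\<Prod>r<n. x - z r)"
        using v x z by (intro f(3) subring_onD(4)[OF subL] subring_on_prod[OF subL] subring_on_diff[OF subL]) auto
      finally show ?thesis by (simp add: poly_prod)
    qed
    then have "range of_nat \<subseteq> {x. poly (?p - ?q) x = 0}" using subring_on_of_nat[OF subL] by auto
    moreover have "infinite (range (of_nat :: nat \<Rightarrow> complex))"
      by (rule range_inj_infinite) (simp add: inj_on_def)
    ultimately have "?p - ?q = 0" using poly_roots_finite finite_subset by blast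
    then show ?thesis by simp
  qed
  ultimately show ?thesis using that by blast
qed

text \<open>The list contains \<open>i\<close> exactly \<open>\<beta> i\<close> times and supplies
  the node sequence of the Newton system, which expresses multiplicity by repetition.\<close>

lemma listing_with_multiplicity:
  obtains zs :: "nat list" where "length zs = (\<Sum>i=1..k. \<beta> i)"
    "\<And>g :: nat \<Rightarrow> 'a::comm_monoid_mult. (\<Prod>r<length zs. g (zs ! r)) = (\<Prod>i=1..k. g i ^ \<beta> i)"
proof -
  have nth: "prod_list (map g zs) = (\<Prod>r<length zs. g (zs ! r))" for g :: "nat \<Rightarrow> 'a" and zs
    by (simp add: prod.list_conv_set_nth atLeast0LessThan)
  have "\<exists>zs. length zs = (\<Sum>i=1..k. \<beta> i) \<and>
    (\<forall>g :: nat \<Rightarrow> 'a. (\<Prod>r<length zs. g (zs ! r)) = (\<Prod>i=1..k. g i ^ \<beta> i))"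
  proof (induction k)
    case (Suc k)
    then obtain zs where zs: "length zs = (\<Sum>i=1..k. \<beta> i)"
      "\<And>g :: nat \<Rightarrow> 'a. prod_list (map g zs) = (\<Prod>i=1..k. g i ^ \<beta> i)"
      by (auto simp: nth)
    have "prod_list (map g (zs @ replicate (\<beta> (Suc k)) (Suc k))) = (\<Prod>i=1..Suc k. g i ^ \<beta> i)" for g :: "nat \<Rightarrow> 'a"
      using zs(2) by (simp add: prod_list_replicate)
    moreover have "length (zs @ replicate (\<beta> (Suc k)) (Suc k)) = (\<Sum>i=1..Suc k. \<beta> i)"
      using zs(1) by simp
    ultimately show ?case unfolding nth by blast
  qed simp
  then show ?thesis using that by blast
qed

text \<open>The logarithmic derivative with denominators cleared.\<close>

lemma pderiv_prod_linear_power: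
  fixes a :: "nat \<Rightarrow> complex"
  shows "pderiv (\<Prod>j\<le>B. [:- a j, 1:] ^ Suc (n j)) =
    (\<Prod>j\<le>B. [:- a j, 1:] ^ n j) * (\<Sum>j\<le>B. smult (of_nat (Suc (n j))) (\<Prod>i\<in>{..B} - {j}. [:- a i, 1:]))"
proof -
  have "prod (\<lambda>j. [:- a j, 1:] ^ Suc (n j)) ({..B} - {j}) * pderiv ([:- a j, 1:] ^ Suc (n j)) =
    (\<Prod>j\<le>B. [:- a j, 1:] ^ n j) * smult (of_nat (Suc (n j))) (\<Prod>i\<in>{..B} - {j}. [:- a i, 1:])"
    if "j \<in> {..B}" for j
  proof -
    have "pderiv ([:- a j, 1:] ^ Suc (n j)) = smult (of_nat (Suc (n j))) ([:- a j, 1:] ^ n j)"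
      by (simp only: pderiv_power_Suc) (simp add: pderiv_pCons)
    moreover have "(\<Prod>j\<le>B. [:- a j, 1:] ^ n j) = [:- a j, 1:] ^ n j * (\<Prod>i\<in>{..B} - {j}. [:- a i, 1:] ^ n i)"
      using that by (simp add: prod.remove)
    ultimately show ?thesis
      by (simp only: power_Suc prod.distrib mult_smult_right mult_smult_left mult.assoc mult.commute mult.left_commute)
  qed
  then show ?thesis by (simp only: pderiv_prod sum_distrib_left cong: sum.cong)
qed

text \<open>Roots of weight one are added until there are \<open>B + 1\<close> distinct roots; then the \<open>b\<close>'s are
  exactly the remaining critical points.\<close>

lemma full_integral_exists_Qbar:
  assumes m: "1 \<le> m" "m \<le> (\<Sum>i=1..k. \<beta> i) + 1" and \<beta>: "\<forall>i\<in>{1..k}. \<beta> i \<ge> 1"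
  obtains a b F where "distinct_points Qbar m a k b" "F \<in> polys_over Qbar"
    "pderiv F = root_product m \<alpha> a * root_product k \<beta> b" "\<forall>t\<in>a ` {1..m}. poly F t = 0"
proof -
  have subQ: "subring_on Qbar" by (intro complex_subfield_imp_subring_on complex_subfield_Qbar)
  define B where "B = (\<Sum>i=1..k. \<beta> i)"
  \<comment> \<open>Indices start at 0 here, so \<open>n j\<close> is the exponent of the root
    number \<open>j + 1\<close>. The added roots have \<open>n j = 0\<close>: they are simple zeros
    of the primitive and drop out of the common factor of the derivative.\<close>
  define n where "n j = (if j < m then \<alpha> (Suc j) else 0)" for j
  \<comment> \<open>The degree of the unnormalised primitive, and so the factor by which its
    derivative fails to be monic.\<close>
  define N where "N = complex_of_nat (\<Sum>j\<le>B. Suc (n j))"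
  have N: "N \<noteq> 0" unfolding N_def by (simp only: of_nat_eq_0_iff) auto
  have NQ: "N \<in> Qbar" "inverse N \<in> Qbar"
    by (auto simp: N_def Qbar_def simp del: of_nat_sum intro!: rat_imp_algebraic)
  obtain zs where zs: "length zs = B"
    "\<And>g :: nat \<Rightarrow> complex poly. (\<Prod>r<length zs. g (zs ! r)) = (\<Prod>i=1..k. g i ^ \<beta> i)"
    using listing_with_multiplicity[of \<beta> k] unfolding B_def by blast
  obtain \<delta> where \<delta>: "\<delta> > 0" "\<And>t::real. \<bar>t\<bar> < \<delta> \<Longrightarrow> (\<exists>c. inj_on c {..B} \<and> (\<forall>j\<le>B. c j \<noteq> 0) \<and>
      (\<forall>j\<le>B. \<forall>r<B. 1 - of_real t * of_nat (zs ! r) * c j \<noteq> 0) \<and>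
      (\<forall>s<B. (\<Sum>j\<le>B. complex_of_real (real (Suc (n j))) *
        newton_kernel (\<lambda>r. of_real t * of_nat (zs ! r)) (Suc s) (c j)) = 0))"
    using newton_system_solvable[of B "\<lambda>j. real (Suc (n j))" "\<lambda>r. of_nat (zs ! r)"] by auto
  obtain p where p: "inverse (real (Suc p)) < \<delta>" using reals_Archimedean[OF \<delta>(1)] by blast
  \<comment> \<open>The scale \<open>1 / (p + 1)\<close> is below \<delta> and rational, which makes
    the \<open>b i\<close> distinct algebraic numbers.\<close>
  define b where "b i = inverse (of_nat (Suc p)) * complex_of_nat i" for i
  define z where "z r = b (zs ! r)" for r
  have z_eq: "(\<lambda>r. inverse (of_nat (Suc p)) * of_nat (zs ! r)) = z" by (auto simp: z_def b_def)
  obtain c where c: "inj_on c {..B}" "\<forall>j\<le>B. c j \<noteq> 0" "\<forall>j\<le>B. \<forall>r<B. 1 - z r * c j \<noteq> 0"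
    "\<forall>s<B. (\<Sum>j\<le>B. of_nat (Suc (n j)) * newton_kernel z (Suc s) (c j)) = 0"
    using \<delta>(2)[of "inverse (real (Suc p))"] p by (auto simp: z_eq z_def b_def simp del: of_nat_Suc)
  have sumN: "(\<Sum>j\<le>B. of_nat (Suc (n j))) = N" by (simp only: N_def of_nat_sum)
  have bQ: "b i \<in> Qbar" for i by (auto simp: b_def Qbar_def simp del: of_nat_Suc intro!: rat_imp_algebraic)
  have crit: "(\<Sum>j\<le>B. smult (of_nat (Suc (n j))) (\<Prod>i\<in>{..B} - {j}. [:- inverse (c i), 1:])) =
    smult N (\<Prod>r<B. [:- z r, 1:])"
    using newton_system_imp_critical_points[of B c z "\<lambda>j. of_nat (Suc (n j))"] c N unfolding sumN by blast
  \<comment> \<open>Weights, \<open>N\<close> and nodes already lie in \<open>Qbar\<close>, so only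
    the roots change under specialization.\<close>
  obtain x where x: "inj_on x {..B}" "x ` {..B} \<subseteq> Qbar"
    "(\<Sum>j\<le>B. smult (of_nat (Suc (n j))) (\<Prod>i\<in>{..B} - {j}. [:- x i, 1:])) = smult N (\<Prod>r<B. [:- z r, 1:])"
  proof (rule critical_points_descend[OF alg_closed_subfield_Qbar _ _ _ _ crit])
    show "inj_on (\<lambda>i. inverse (c i)) {..B}" using c(1) by (auto simp: inj_on_def)
  qed (use bQ NQ in \<open>auto simp: z_def Qbar_def simp del: of_nat_Suc\<close>)
  have "(\<Prod>r<B. [:- z r, 1:]) = root_product k \<beta> b"
    using zs(2)[of "\<lambda>i. [:- b i, 1:]"] zs(1) by (simp add: z_def root_product_def)
  note x = x(1,2) x(3)[unfolded this]
  \<comment> \<open>Back to numbering from 1; the points with index above \<open>m\<close> are the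
    added simple roots.\<close>
  define a where "a j = x (j - 1)" for j
  define F where "F = smult (inverse N) (root_product (Suc B) (\<lambda>j. Suc (n (j - 1))) a)"
  have prod_eq: "root_product l \<gamma> a = (\<Prod>j<l. [:- x j, 1:] ^ \<gamma> (Suc j))" for l \<gamma>
    by (simp add: root_product_def a_def prod.atLeast1_atMost_eq)
  have aQ: "a ` {1..Suc B} \<subseteq> Qbar" using x(2) by (auto simp: a_def image_subset_iff)
  have "(\<Prod>j\<le>B. [:- x j, 1:] ^ n j) = root_product m \<alpha> a"
    unfolding prod_eq using m(2) by (intro prod.mono_neutral_cong_right) (auto simp: n_def B_def)
  then have "pderiv F = root_product m \<alpha> a * root_product k \<beta> b"
    unfolding F_def prod_eq lessThan_Suc_atMost using N x(3)
    by (simp add: pderiv_smult pderiv_prod_linear_power del: power_Suc of_nat_Suc)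
  moreover have "F \<in> polys_over Qbar"
    unfolding F_def using complex_subfield_Qbar aQ
    by (intro polys_over_smult_subring[OF subQ] polys_over_root_product) (auto intro: NQ)
  moreover have "\<forall>t\<in>a ` {1..m}. poly F t = 0"
  proof
    fix t assume "t \<in> a ` {1..m}"
    then obtain j where j: "j \<in> {1..m}" "t = x (j - 1)" by (auto simp: a_def)
    then have "j - 1 \<in> {..<Suc B}" using m by (auto simp: B_def)
    then have "poly (root_product (Suc B) (\<lambda>j. Suc (n (j - 1))) a) t = 0"
      unfolding prod_eq poly_prod using j(2) by (intro prod_zero) auto
    then show "poly F t = 0" by (simp add: F_def)
  qed
  moreover have "distinct_points Qbar m a k b"
    unfolding distinct_points_def
  proof (intro conjI)
    show "a ` {1..m} \<subseteq> Qbar" using aQ m by (force simp: B_def)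
    show "b ` {1..k} \<subseteq> Qbar" using bQ by auto
    show "inj_on b {1..k}" by (auto simp: inj_on_def b_def simp del: of_nat_Suc)
    show "inj_on a {1..m}"
    proof (rule inj_onI)
      fix i j assume "i \<in> {1..m}" "j \<in> {1..m}" "a i = a j"
      then have "i - 1 = j - 1" using m by (intro inj_onD[OF x(1)]) (auto simp: a_def B_def)
      then show "i = j" using \<open>i \<in> _\<close> \<open>j \<in> _\<close> by auto
    qed
    show "a ` {1..m} \<inter> b ` {1..k} = {}"
    proof (rule ccontr)
      assume "\<not> ?thesis"
      then obtain t where "t \<in> a ` {1..m}" "t \<in> b ` {1..k}" by blast
      then obtain j i where ij: "j \<in> {1..m}" "i \<in> {1..k}" "x (j - 1) = b i" by (auto simp only: a_def)
      define q where "q = j - 1"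
      have q: "q \<le> B" using ij m by (auto simp: q_def B_def)
      have "\<beta> i \<noteq> 0" using \<beta> ij(2) by force
      then have "poly (root_product k \<beta> b) (x q) = 0"
        unfolding root_product_def poly_prod using ij by (intro prod_zero) (auto simp: q_def intro!: bexI[of _ i])
      \<comment> \<open>At \<open>x q\<close> every summand with another index contains the factor
        \<open>x q - x q\<close>. The remaining one is a positive integer times a product of nonzero
        differences.\<close>
      then have "0 = (\<Sum>j\<le>B. of_nat (Suc (n j)) * (\<Prod>i\<in>{..B} - {j}. x q - x i))"
        using arg_cong[OF x(3), of "\<lambda>p. poly p (x q)"] by (simp add: poly_sum poly_prod del: of_nat_Suc)
      also have "\<dots> = (\<Sum>j\<in>{q}. of_nat (Suc (n j)) * (\<Prod>i\<in>{..B} - {j}. x q - x i))"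
        using q by (intro sum.mono_neutral_right) (auto intro!: prod_zero)
      finally have "(\<Prod>i\<in>{..B} - {q}. x q - x i) = 0" by (simp del: of_nat_Suc)
      then show False using x(1) q by (auto simp: inj_on_def)
    qed
  qed
  ultimately show ?thesis using that by blast
qed

theorem theorem2p3:
  fixes K :: "complex set"
    and m k n M :: nat
    and \<alpha> \<beta> :: "nat \<Rightarrow> nat"
  assumes "alg_closed_subfield K"
    and "\<forall>j\<in>{1..m}. \<alpha> j \<ge> 2"
    and "\<forall>i\<in>{1..k}. \<beta> i \<ge> 1"
    and "n = (\<Sum>j=1..m. \<alpha> j) + (\<Sum>i=1..k. \<beta> i)"
    and "M = (\<Sum>j=1..m. \<alpha> j)"
  shows
    "(m = 0 \<longrightarrow>
        (\<forall>b. b ` {1..k} \<subseteq> K \<and> inj_on b {1..k} \<longrightarrow>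
          (\<exists>F. full_integral K {} (root_product k \<beta> b) F))) \<and>
     (m = 1 \<longrightarrow>
        (\<forall>a b. a \<in> K \<and> b ` {1..k} \<subseteq> K \<and> inj_on b {1..k} \<and> a \<notin> b ` {1..k} \<longrightarrow>
          (\<exists>F. full_integral K {a} ([:- a, 1:] ^ \<alpha> 1 * root_product k \<beta> b) F))) \<and>
     (2 \<le> m \<and> m \<le> n - M + 1 \<longrightarrow>
        (\<exists>a b. distinct_points Qbar m a k b \<and>
          (\<exists>F. full_integral K (a ` {1..m}) (root_product m \<alpha> a * root_product k \<beta> b) F)) \<and>
        (\<exists>a' b'. distinct_points Qbar m a' k b' \<and>
          \<not> (\<exists>F. full_integral K (a' ` {1..m}) (root_product m \<alpha> a' * root_product k \<beta> b') F))) \<and>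
     (m > n - M + 1 \<longrightarrow>
        (\<forall>a b. distinct_points K m a k b \<longrightarrow>
          \<not> (\<exists>F. full_integral K (a ` {1..m}) (root_product m \<alpha> a * root_product k \<beta> b) F))) \<and>
     ((\<exists>a b. distinct_points K m a k b \<and>
          full_integrable K (a ` {1..m}) (root_product m \<alpha> a * root_product k \<beta> b))
        \<longleftrightarrow> m \<le> n - M + 1)"
proof -
  note \<alpha> = assms(2)
  have K: "complex_subfield K" using assms(1) by (simp add: alg_closed_subfield_def)
  have subK: "subring_on K" using K by (rule complex_subfield_imp_subring_on)
  \<comment> \<open>The truncated subtraction is exact because \<open>M\<close> is a summand of
    \<open>n\<close>.\<close>
  have nM: "n - M = (\<Sum>i=1..k. \<beta> i)" using assms(4,5) by simp
  have QK: "Qbar \<subseteq> K" using assms(1) by (rule Qbar_subset)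
  have dQK: "distinct_points K m a k b" if "distinct_points Qbar m a k b" for a b
    using that QK by (auto simp: distinct_points_def)
  have part1: "\<exists>F. full_integral K {} (root_product k \<beta> b) F" if "b ` {1..k} \<subseteq> K" for b
  proof -
    have "root_product k \<beta> b \<in> polys_over K" using polys_over_root_product[OF K that] .
    then show ?thesis
      using antiderivative_over[OF K, of _ 0] subring_onD(1)[OF subK] by (metis (no_types) full_integral_def empty_iff empty_subsetI)
  qed
  have part2: "\<exists>F. full_integral K {a} ([:- a, 1:] ^ \<alpha> 1 * root_product k \<beta> b) F"
    if ab: "m = 1" "a \<in> K" "b ` {1..k} \<subseteq> K" for a b
  proof -
    let ?f = "[:- a, 1:] ^ \<alpha> 1 * root_product k \<beta> b"
    have rp: "root_product 1 \<alpha> (\<lambda>_. a) = [:- a, 1:] ^ \<alpha> 1" by (simp add: root_product_def)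
    have "[:- a, 1:] ^ \<alpha> 1 \<in> polys_over K"
      using polys_over_root_product[OF K, of "\<lambda>_. a" 1 \<alpha>] that(2) unfolding rp by auto
    then have f: "?f \<in> polys_over K" using polys_over_root_product[OF K that(3)] by (intro polys_over_mult[OF K])
    have "{a} \<subseteq> multiple_zeros K ?f"
      using multiple_zeros_root_product[of "\<lambda>_. a" 1 K \<alpha> "root_product k \<beta> b"] that(1,2) \<alpha> unfolding rp by auto
    moreover obtain F where "F \<in> polys_over K" "pderiv F = ?f" "poly F a = 0"
      using antiderivative_over[OF K f ab(2)] by blast
    ultimately show ?thesis using f by (auto simp: full_integral_def)
  qed
  \<comment> \<open>Stated from \<open>1 \<le> m\<close> on, so that it also supplies the case
    \<open>m = 1\<close> of the final equivalence.\<close>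
  have part3: "\<exists>a b. distinct_points Qbar m a k b \<and>
      (\<exists>F. full_integral K (a ` {1..m}) (root_product m \<alpha> a * root_product k \<beta> b) F)"
    if m: "1 \<le> m" "m \<le> n - M + 1"
  proof -
    obtain a b F where *: "distinct_points Qbar m a k b" "F \<in> polys_over Qbar"
      "pderiv F = root_product m \<alpha> a * root_product k \<beta> b" "\<forall>t\<in>a ` {1..m}. poly F t = 0"
      using full_integral_exists_Qbar[OF m[unfolded nM] assms(3), of \<alpha>] by blast
    then have "full_integral K (a ` {1..m}) (root_product m \<alpha> a * root_product k \<beta> b) F"
      using polys_over_mono[OF QK] by (subst full_integral_product_iff[OF K dQK \<alpha> refl]) auto
    then show ?thesis using * by blast
  qed
  have part3': "\<exists>a' b'. distinct_points Qbar m a' k b' \<and>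
      \<not> (\<exists>F. full_integral K (a' ` {1..m}) (root_product m \<alpha> a' * root_product k \<beta> b') F)"
    if "2 \<le> m"
  proof (intro exI conjI notI)
    \<comment> \<open>Consecutive integers serve as the points, with the \<open>a j\<close> first,
      so that 1 and 2 are adjacent zeros at which \<open>F\<close> would have to agree.\<close>
    show *: "distinct_points Qbar m of_nat k (\<lambda>i. of_nat (m + i))"
      by (intro distinct_points_of_nat complex_subfield_imp_subring_on complex_subfield_Qbar)
    assume "\<exists>F. full_integral K (of_nat ` {1..m}) (root_product m \<alpha> of_nat * root_product k \<beta> (\<lambda>i. of_nat (m + i))) F"
    then obtain F where F: "pderiv F = root_product m \<alpha> of_nat * root_product k \<beta> (\<lambda>i. of_nat (m + i))"
      "\<forall>t\<in>of_nat ` {1..m}. poly F t = 0" by (auto simp: full_integral_def)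
    have "1 \<in> complex_of_nat ` {1..m}" "2 \<in> complex_of_nat ` {1..m}"
      using that by (auto intro: image_eqI[of _ _ 1] image_eqI[of _ _ 2])
    then show False using no_common_value_on_integers[OF that F(1)] F(2) by simp
  qed
  have part4: "m \<le> n - M + 1" if "distinct_points K m a k b"
    "full_integral K (a ` {1..m}) (root_product m \<alpha> a * root_product k \<beta> b) F" for a b F
    using integral_root_bound[OF _ \<alpha>] that unfolding nM by (auto simp: distinct_points_def full_integral_def)
  have last: "\<exists>a b. distinct_points K m a k b \<and>
      full_integrable K (a ` {1..m}) (root_product m \<alpha> a * root_product k \<beta> b)" if "m \<le> n - M + 1"
  \<comment> \<open>Without any \<open>a j\<close> there is no vanishing condition, and arbitrary
    distinct points \<open>b i\<close> do.\<close>
  proof (cases "m = 0")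
    case True
    have "distinct_points K m of_nat k (\<lambda>i. of_nat (m + i))" by (rule distinct_points_of_nat[OF subK])
    moreover from this have "\<exists>F. full_integral K {} (root_product k \<beta> (\<lambda>i. of_nat (m + i))) F"
      by (intro part1) (simp add: distinct_points_def)
    moreover have "root_product 0 \<alpha> of_nat = 1" by (simp add: root_product_def)
    ultimately show ?thesis unfolding full_integrable_def using True
      by (intro exI[of _ of_nat] exI[of _ "\<lambda>i. of_nat (m + i)"]) simp
  next
    case False
    then show ?thesis using part3 that dQK unfolding full_integrable_def by (metis One_nat_def Suc_leI neq0_conv)
  qed
  show ?thesis
  proof (intro conjI impI allI notI)
    show "(\<exists>a b. distinct_points K m a k b \<and>
          full_integrable K (a ` {1..m}) (root_product m \<alpha> a * root_product k \<beta> b)) \<longleftrightarrow> m \<le> n - M + 1"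
      using last part4 unfolding full_integrable_def by blast
  qed (use part1 part2 part3 part3' part4 in \<open>auto simp: not_less[symmetric]\<close>)
qed

end
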